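(* A combinatorial polytope $\mathcal{P}$ has an antiprism if and only if it has a balanced pair. Moreover, if $(P_0,P_1)$ is a balanced pair, then $$\operatorname{conv}\big((P_0\times\{0\})\cup(P_1^*\times\{1\})\big)$$ is an antiprism of $P_0$.
   Context: A combinatorial polytope $\mathcal{P}$ is a bounded poset (least element $\bot$, greatest $\top$) isomorphic to the face lattice of a convex polytope; a realization is a polytope $P$ with an isomorphism from $\mathcal{P}$ to its face lattice, and $\operatorname{face}(P,f)$ is the face with index $f$. Antiprism: let $\mathcal{P}^*$ be $\mathcal{P}$ with order reversed, $f^*\in\mathcal{P}^*$ corresponding to $f\in\mathcal{P}$. The abstract antiprism of $\mathcal{P}$ is the poset $\{(g,f^* )\in\mathcal{P}\times\mathcal{P}^*: g\le f\}$ with the product order ($(g,f^* )\le(g',f'^* )$ iff $g\le g'$ and $f\ge f'$), together with a greatest element; equivalently, the poset of all intervals of $\mathcal{P}$, including the empty one, ordered by reverse inclusion. An antiprism of $\mathcal{P}$ (or of a realization of $\mathcal{P}$) is a polytope whose face lattice is isomorphic to this poset; $\mathcal{P}$ has an antiprism if such a polytope exists. Balanced pair: a polytope in $\mathbb{R}^d$ is centered if it contains the origin in its interior; $P^*=\{x:\langle x,p\rangle\le1\ \forall p\in P\}$ is the polar of a centered polytope $P$. For $g\ne\bot$, $\operatorname{ncone}(P,g)$ is the set of $u\in\mathbb{R}^d$ such that $\langle u,\cdot\rangle$ attains its maximum over $P$ at every point of $\operatorname{face}(P,g)$; $X^\circ$ denotes relative interior. An ordered pair $(P_1,P_2)$ of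 centered realizations in $\mathbb{R}^d$ of the same combinatorial polytope is balanced if for all indices $g,f\neq\bot$, $$\operatorname{ncone}(P_1,g)^\circ\cap\operatorname{face}(P_2,f)^\circ\neq\emptyset\iff g\le f .$$ $\mathcal{P}$ has a balanced pair if there is a balanced pair of realizations of $\mathcal{P}$. *)

theory Defs
  imports "HOL-Analysis.Analysis"
begin

text \<open>
  A poset is a carrier \<open>A\<close> with a relation \<open>le\<close>, of which only the restriction to \<open>A\<close> matters.

  The dimension of a space cannot be quantified over inside a formula when it is part of a type.
  Therefore \<open>\<real>\<^sup>d\<close> is presented as a \<open>d\<close>-dimensional linear subspace \<open>V\<close> of a Euclidean space
  type, with the induced inner product and topology; \<open>d = 0\<close> is included, and \<open>V = UNIV\<close> is the
  literal case.  Interior and polar, which depend on the ambient space, take \<open>V\<close> as an argument.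
\<close>

definition bounded_poset :: "'p set \<Rightarrow> ('p \<Rightarrow> 'p \<Rightarrow> bool) \<Rightarrow> 'p \<Rightarrow> 'p \<Rightarrow> bool" where
  "bounded_poset A le bt tp \<longleftrightarrow>
     reflp_on A le \<and> antisymp_on A le \<and> transp_on A le \<and>
     bt \<in> A \<and> tp \<in> A \<and> (\<forall>x\<in>A. le bt x \<and> le x tp)"

definition poset_iso ::
  "'p set \<Rightarrow> ('p \<Rightarrow> 'p \<Rightarrow> bool) \<Rightarrow> 'q set \<Rightarrow> ('q \<Rightarrow> 'q \<Rightarrow> bool) \<Rightarrow> ('p \<Rightarrow> 'q) \<Rightarrow> bool" where
  "poset_iso A le B le' \<phi> \<longleftrightarrow>
     bij_betw \<phi> A B \<and> (\<forall>x\<in>A. \<forall>y\<in>A. le x y \<longleftrightarrow> le' (\<phi> x) (\<phi> y))"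

text \<open>
  The library's \<open>face_of\<close> counts both \<open>{}\<close> and \<open>P\<close> as faces of \<open>P\<close>, so ordering all
  faces by inclusion gives the face lattice.
\<close>

definition face_lattice_iso ::
  "'p set \<Rightarrow> ('p \<Rightarrow> 'p \<Rightarrow> bool) \<Rightarrow> 'a::euclidean_space set \<Rightarrow> ('p \<Rightarrow> 'a set) \<Rightarrow> bool" where
  "face_lattice_iso A le P \<phi> \<longleftrightarrow> poset_iso A le {F. F face_of P} (\<subseteq>) \<phi>"

text \<open>
  A realization is the polytope \<open>P\<close> together with the isomorphism \<open>\<phi>\<close>, and \<open>\<phi> f\<close> is the face of
  \<open>P\<close> with index \<open>f\<close>.  Polytopes are nonempty.  A combinatorial polytope is a bounded poset
  that has a realization.
\<close>

definition realization ::
  "'p set \<Rightarrow> ('p \<Rightarrow> 'p \<Rightarrow> bool) \<Rightarrow> 'a::euclidean_space set \<Rightarrow> ('p \<Rightarrow> 'a set) \<Rightarrow> bool" where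
  "realization A le P \<phi> \<longleftrightarrow> polytope P \<and> P \<noteq> {} \<and> face_lattice_iso A le P \<phi>"

text \<open>
  In the abstract antiprism, \<open>Some (g, f)\<close> stands for the pair of \<open>g\<close> and the dual element of
  \<open>f\<close>, and \<open>None\<close> for the additional greatest element.
\<close>

definition antiprism_carrier :: "'p set \<Rightarrow> ('p \<Rightarrow> 'p \<Rightarrow> bool) \<Rightarrow> ('p \<times> 'p) option set" where
  "antiprism_carrier A le = insert None (Some ` {(g, f). g \<in> A \<and> f \<in> A \<and> le g f})"

fun antiprism_le ::
  "('p \<Rightarrow> 'p \<Rightarrow> bool) \<Rightarrow> ('p \<times> 'p) option \<Rightarrow> ('p \<times> 'p) option \<Rightarrow> bool" where
  "antiprism_le le x None \<longleftrightarrow> True"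
| "antiprism_le le None (Some y) \<longleftrightarrow> False"
| "antiprism_le le (Some (g, f)) (Some (g', f')) \<longleftrightarrow> le g g' \<and> le f' f"

definition antiprism ::
  "'p set \<Rightarrow> ('p \<Rightarrow> 'p \<Rightarrow> bool) \<Rightarrow> 'b::euclidean_space set \<Rightarrow> bool" where
  "antiprism A le K \<longleftrightarrow>
     polytope K \<and> (\<exists>\<psi>. face_lattice_iso (antiprism_carrier A le) (antiprism_le le) K \<psi>)"

definition has_antiprism ::
  "'b::euclidean_space itself \<Rightarrow> 'p set \<Rightarrow> ('p \<Rightarrow> 'p \<Rightarrow> bool) \<Rightarrow> bool" where
  "has_antiprism _ A le \<longleftrightarrow> (\<exists>K :: 'b set. antiprism A le K)"

definition centered :: "'a::euclidean_space set \<Rightarrow> 'a set \<Rightarrow> bool" where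
  "centered V P \<longleftrightarrow> P \<subseteq> V \<and> 0 \<in> (top_of_set V) interior_of P"

definition polar :: "'a::euclidean_space set \<Rightarrow> 'a set \<Rightarrow> 'a set" where
  "polar V P = {x \<in> V. \<forall>p\<in>P. x \<bullet> p \<le> 1}"

text \<open>The normal cone of \<open>P\<close> at its nonempty face \<open>F\<close>.\<close>

definition ncone :: "'a::euclidean_space set \<Rightarrow> 'a set \<Rightarrow> 'a set \<Rightarrow> 'a set" where
  "ncone V P F = {u \<in> V. \<forall>x\<in>F. \<forall>y\<in>P. u \<bullet> y \<le> u \<bullet> x}"

definition balanced_pair ::
  "'p set \<Rightarrow> ('p \<Rightarrow> 'p \<Rightarrow> bool) \<Rightarrow> 'p \<Rightarrow> 'a::euclidean_space set \<Rightarrow>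
     'a set \<Rightarrow> ('p \<Rightarrow> 'a set) \<Rightarrow> 'a set \<Rightarrow> ('p \<Rightarrow> 'a set) \<Rightarrow> bool" where
  "balanced_pair A le bt V P\<^sub>1 \<phi>\<^sub>1 P\<^sub>2 \<phi>\<^sub>2 \<longleftrightarrow>
     subspace V \<and>
     realization A le P\<^sub>1 \<phi>\<^sub>1 \<and> centered V P\<^sub>1 \<and>
     realization A le P\<^sub>2 \<phi>\<^sub>2 \<and> centered V P\<^sub>2 \<and>
     (\<forall>g\<in>A - {bt}. \<forall>f\<in>A - {bt}.
        rel_interior (ncone V P\<^sub>1 (\<phi>\<^sub>1 g)) \<inter> rel_interior (\<phi>\<^sub>2 f) \<noteq> {} \<longleftrightarrow> le g f)"

definition has_balanced_pair ::
  "'a::euclidean_space itself \<Rightarrow> 'p set \<Rightarrow> ('p \<Rightarrow> 'p \<Rightarrow> bool) \<Rightarrow> 'p \<Rightarrow> bool" where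
  "has_balanced_pair _ A le bt \<longleftrightarrow>
     (\<exists>(V :: 'a set) P\<^sub>1 \<phi>\<^sub>1 P\<^sub>2 \<phi>\<^sub>2. balanced_pair A le bt V P\<^sub>1 \<phi>\<^sub>1 P\<^sub>2 \<phi>\<^sub>2)"

text \<open>
  Both existence notions have their ambient type as a parameter.  Since a polytope may be embedded
  in any larger space, and its dimension is determined by its face lattice, existence in some
  Euclidean space is the same as existence in any one type that is large enough: for a
  combinatorial polytope of dimension \<open>d\<close>, at least \<open>d\<close> for balanced pairs, and more than \<open>d\<close>
  for antiprisms.
\<close>

end

theory Submission
  imports Defs
begin

text \<open>
  A face of \<open>conv (P\<^sub>0 \<times> {0} \<union> R \<times> {1})\<close> other than the whole polytope is the hull of
  \<open>G \<times> {0} \<union> H \<times> {1}\<close> for faces \<open>G\<close> of \<open>P\<^sub>0\<close> and \<open>H\<close> of \<open>R\<close>.  If both are nonempty, such a hull is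
  a face iff some linear functional is maximized over \<open>P\<^sub>0\<close> exactly on \<open>G\<close> and over \<open>R\<close> exactly on
  \<open>H\<close>, that is, iff the relative interiors of the two normal cones meet.  When \<open>R\<close> is the polar of
  \<open>P\<^sub>1\<close> and \<open>H\<close> is dual to a proper face \<open>F\<close> of \<open>P\<^sub>1\<close>, the relative interior of the normal cone of
  \<open>R\<close> at \<open>H\<close> is the open cone over that of \<open>F\<close>, so this is the condition in the definition of
  balanced pairs.

  For the converse, the facets of an antiprism with indices \<open>(\<top>, \<top>)\<close> and \<open>(\<bottom>, \<bottom>)\<close> are disjoint and
  contain all vertices.  A projective transformation makes them parallel, and projecting along a
  segment joining interior points of the two facets gives centered polytopes \<open>P\<^sub>0\<close> and \<open>R\<close>, to which
  the first part applies with \<open>P\<^sub>1\<close> the polar of \<open>R\<close>.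
\<close>

section \<open>Normal cones of polytopes\<close>

text \<open>Only the direction \<open>u\<close> of a functional matters for the criterion because
  the height coordinate is free: a functional on the hull is a functional \<open>u\<close> on
  \<open>V\<close> plus an arbitrary offset between the two levels, so the maxima at both ends can
  always be made equal. The pairs that escape this criterion dictate the case distinctions. For
  \<open>g = bt\<close> or \<open>f = tp\<close> one end is empty and the hull is a face of the
  bottom or the top. For \<open>f = bt\<close> and \<open>g\<close> other than \<open>bt\<close> the
  functional would be constant on \<open>R\<close>, hence zero on \<open>V\<close>, which leaves
  only the whole polytope, the added greatest element. A projective transformation is not affine, so
  neither convex hulls nor dimensions follow it directly. What it preserves are open segments, and
  convexity and faces are defined by these alone. Dimension is recovered from the face lattice, as
  the length of chains of faces; the same comparison shows that the facets of an antiprism fit into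
  the space of the given realization \<open>Q\<close>.\<close>

definition argmax_face :: "'a::euclidean_space \<Rightarrow> 'a set \<Rightarrow> 'a set" where
  "argmax_face u P = {x \<in> P. \<forall>y\<in>P. u \<bullet> y \<le> u \<bullet> x}"

lemma argmax_face_eq:
  assumes "x \<in> argmax_face u P"
  shows "argmax_face u P = P \<inter> {y. u \<bullet> y = u \<bullet> x}"
  using assms by (auto simp: argmax_face_def intro: antisym)

lemma argmax_face_scaleR: "c > 0 \<Longrightarrow> argmax_face (c *\<^sub>R u) P = argmax_face u P"
  by (auto simp: argmax_face_def)

lemma argmax_face_zero [simp]: "argmax_face 0 P = P"
  by (auto simp: argmax_face_def)

text \<open>Orthogonal projection of \<open>u\<close> to \<open>V\<close>. Hyperplanes exposing
  faces come from the whole type, while normal cones and polars are taken inside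
  \<open>V\<close>.\<close>

lemma subspace_inner_representative:
  fixes V :: "'a::euclidean_space set"
  assumes "subspace V"
  obtains v where "v \<in> V" "\<And>x. x \<in> V \<Longrightarrow> v \<bullet> x = u \<bullet> x"
proof -
  obtain y z where yz: "y \<in> span V" "\<And>w. w \<in> span V \<Longrightarrow> orthogonal z w" "u = y + z"
    using orthogonal_subspace_decomp_exists[of V u] by metis
  have "y \<bullet> x = u \<bullet> x" if "x \<in> V" for x
    using yz(2)[OF span_base[OF that]] by (simp add: yz(3) inner_add_left orthogonal_def)
  moreover have "y \<in> V" using yz(1) assms by (simp add: span_eq_iff[THEN iffD2])
  ultimately show thesis using that by blast
qed

lemma argmax_face_cong:
  assumes "\<And>x. x \<in> P \<Longrightarrow> v \<bullet> x = u \<bullet> x"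
  shows "argmax_face v P = argmax_face u P"
  using assms by (auto simp: argmax_face_def)

text \<open>Faces of polyhedra are exposed. An exposing hyperplane is available only for proper
  faces; \<open>P\<close> itself is exposed by the zero functional.\<close>

lemma face_eq_argmax_face:
  assumes "polytope P" "F face_of P" "F \<noteq> {}" "subspace V" "P \<subseteq> V"
  obtains u where "u \<in> V" "argmax_face u P = F"
proof -
  have "\<exists>u. argmax_face u P = F"
  proof (cases "F = P")
    case True
    then show ?thesis by (intro exI[of _ 0]) simp
  next
    case False
    have "F exposed_face_of P"
      using assms exposed_face_of_polyhedron polytope_imp_polyhedron by blast
    then obtain a b where ab: "P \<subseteq> {x. a \<bullet> x \<le> b}" "F = P \<inter> {x. a \<bullet> x = b}"
      using False assms(3) by (auto simp: exposed_face_of)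
    have "argmax_face a P = F"
      using ab assms(3) unfolding argmax_face_def by (auto intro: antisym) 
    then show ?thesis ..
  qed
  then obtain u where u: "argmax_face u P = F" ..
  obtain v where v: "v \<in> V" "\<And>x. x \<in> V \<Longrightarrow> v \<bullet> x = u \<bullet> x"
    using subspace_inner_representative[OF assms(4)] by metis
  then have "argmax_face v P = argmax_face u P"
    using assms(5) by (intro argmax_face_cong) blast
  with u v that show thesis by simp
qed

lemma argmax_face_imp_ncone: "u \<in> V \<Longrightarrow> argmax_face u P = F \<Longrightarrow> u \<in> ncone V P F"
  by (auto simp: argmax_face_def ncone_def)

lemma convex_ncone:
  assumes "subspace V"
  shows "convex (ncone V P F)"
proof (rule convexI)
  fix u v and a b :: real
  assume uv: "u \<in> ncone V P F" "v \<in> ncone V P F" and ab: "0 \<le> a" "0 \<le> b"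
  have "a *\<^sub>R u + b *\<^sub>R v \<in> V"
    using uv assms by (simp add: ncone_def subspace_add subspace_scale)
  moreover have "(a *\<^sub>R u + b *\<^sub>R v) \<bullet> y \<le> (a *\<^sub>R u + b *\<^sub>R v) \<bullet> x" if "x \<in> F" "y \<in> P" for x y
    using uv ab that by (auto simp: ncone_def inner_add_left intro!: add_mono mult_left_mono)
  ultimately show "a *\<^sub>R u + b *\<^sub>R v \<in> ncone V P F"
    by (simp add: ncone_def)
qed

text \<open>Membership in the normal cone allows further maximizers outside \<open>F\<close>; the
  relative interior forbids them. Both inclusions use that a point is relatively interior iff every
  segment of the cone ending there can be prolonged a little within the cone.\<close>

lemma rel_interior_ncone:
  assumes P: "polytope P" and F: "F face_of P" "F \<noteq> {}" and V: "subspace V" "P \<subseteq> V"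
  shows "rel_interior (ncone V P F) = {u \<in> V. argmax_face u P = F}"
proof (intro equalityI subsetI)
  let ?N = "ncone V P F"
  obtain w where w: "w \<in> V" "argmax_face w P = F"
    using face_eq_argmax_face[OF P F V] by metis
  have "?N \<noteq> {}" using argmax_face_imp_ncone[OF w] by blast
  note ri = convex_rel_interior_iff[OF convex_ncone[OF V(1)] this]
  have FP: "F \<subseteq> P" using F by (simp add: face_of_imp_subset)
  {
    fix u assume u: "u \<in> rel_interior ?N"
    then have uN: "u \<in> ?N" using rel_interior_subset by blast
    \<comment> \<open>Prolong the segment from \<open>w\<close>, which exposes exactly
      \<open>F\<close>, beyond \<open>u\<close>. Moving away from \<open>w\<close> favours points
      outside \<open>F\<close>, so a maximizer \<open>y\<close> of \<open>u\<close> outside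
      \<open>F\<close> would then beat \<open>F\<close>.\<close>
    obtain e where e: "e > 1" "(1 - e) *\<^sub>R w + e *\<^sub>R u \<in> ?N"
      using u argmax_face_imp_ncone[OF w] unfolding ri by blast
    have "y \<in> F" if y: "y \<in> argmax_face u P" for y
    proof (rule ccontr)
      assume "y \<notin> F"
      obtain x where x: "x \<in> F" using F by blast
      have yP: "y \<in> P" using y by (simp add: argmax_face_def)
      have "w \<bullet> y < w \<bullet> x"
        using \<open>y \<notin> F\<close> x w(2) yP argmax_face_eq[of x w P] by (fastforce simp: argmax_face_def)
      moreover have "u \<bullet> y = u \<bullet> x"
        using y x FP uN yP by (intro antisym) (auto simp: argmax_face_def ncone_def)
      moreover have "((1 - e) *\<^sub>R w + e *\<^sub>R u) \<bullet> y \<le> ((1 - e) *\<^sub>R w + e *\<^sub>R u) \<bullet> x"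
        using e(2) x yP by (simp add: ncone_def)
      ultimately have "(1 - e) * (w \<bullet> y) \<le> (1 - e) * (w \<bullet> x)"
        by (simp add: inner_add_left)
      with e(1) \<open>w \<bullet> y < w \<bullet> x\<close> show False
        by (simp add: mult_le_cancel_left)
    qed
    moreover have "F \<subseteq> argmax_face u P"
      using uN FP by (auto simp: argmax_face_def ncone_def)
    ultimately show "u \<in> {u \<in> V. argmax_face u P = F}"
      using uN by (auto simp: ncone_def)
  }
  {
    fix u assume "u \<in> {u \<in> V. argmax_face u P = F}"
    then have u: "u \<in> V" "argmax_face u P = F" by auto
    obtain X where X: "finite X" "P = convex hull X"
      using P by (auto simp: polytope_def)
    obtain p where p: "p \<in> F" using F by blast
    show "u \<in> rel_interior ?N"
      unfolding ri
    proof
      fix v assume v: "v \<in> ?N"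
      have XP: "X \<subseteq> P" using X by (simp add: hull_subset)
      \<comment> \<open>Each of the finitely many generators off \<open>F\<close> has a strictly
        smaller value of \<open>u\<close>, so one step size keeps the perturbation by
        \<open>u - v\<close> below all these gaps.\<close>
      have "\<exists>\<epsilon>>0. \<forall>d\<in>X - F. \<epsilon> * \<bar>(u - v) \<bullet> (p - d)\<bar> \<le> u \<bullet> (p - d)"
      proof -
        have "\<exists>\<epsilon>>0. \<epsilon> * \<bar>(u - v) \<bullet> (p - d)\<bar> \<le> u \<bullet> (p - d)" if d: "d \<in> X - F" for d
        proof -
          have "u \<bullet> d < u \<bullet> p"
            using d p u(2) XP argmax_face_eq[of p u P] by (fastforce simp: argmax_face_def)
          then have pos: "0 < u \<bullet> (p - d)" by (simp add: inner_diff_right)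
          \<comment> \<open>The summand 1 keeps the denominator positive when \<open>u - v\<close>
            does not distinguish \<open>p\<close> from \<open>d\<close>.\<close>
          let ?\<epsilon> = "u \<bullet> (p - d) / (\<bar>(u - v) \<bullet> (p - d)\<bar> + 1)"
          have "?\<epsilon> > 0" using pos by (simp add: add_nonneg_pos)
          moreover have "?\<epsilon> * \<bar>(u - v) \<bullet> (p - d)\<bar> \<le> u \<bullet> (p - d)"
            using pos by (simp add: field_simps add_nonneg_pos)
          ultimately show ?thesis by blast
        qed
        then obtain E where E: "\<And>d. d \<in> X - F \<Longrightarrow> E d > 0 \<and> E d * \<bar>(u - v) \<bullet> (p - d)\<bar> \<le> u \<bullet> (p - d)"
          by metis
        \<comment> \<open>The inserted 1 provides a minimum when all generators lie in
          \<open>F\<close>.\<close>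
        define m where "m = Min (insert 1 (E ` (X - F)))"
        have "m > 0" using E X(1) by (auto simp: m_def)
        moreover have "m * \<bar>(u - v) \<bullet> (p - d)\<bar> \<le> u \<bullet> (p - d)" if "d \<in> X - F" for d
        proof -
          have "m \<le> E d" using that X(1) by (auto simp: m_def)
          then have "m * \<bar>(u - v) \<bullet> (p - d)\<bar> \<le> E d * \<bar>(u - v) \<bullet> (p - d)\<bar>"
            by (rule mult_right_mono) simp
          then show ?thesis using E[OF that] by linarith
        qed
        ultimately show ?thesis by blast
      qed
      then obtain \<epsilon> where \<epsilon>: "\<epsilon> > 0" "\<And>d. d \<in> X - F \<Longrightarrow> \<epsilon> * \<bar>(u - v) \<bullet> (p - d)\<bar> \<le> u \<bullet> (p - d)"
        by blast
      let ?z = "(1 - (1 + \<epsilon>)) *\<^sub>R v + (1 + \<epsilon>) *\<^sub>R u"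
      have z: "?z = u + \<epsilon> *\<^sub>R (u - v)" by (simp add: algebra_simps)
      have const: "u \<bullet> x = u \<bullet> p" "v \<bullet> x = v \<bullet> p" if "x \<in> F" for x
        using u v p that FP by (auto simp: argmax_face_def ncone_def intro!: antisym)
      have le: "?z \<bullet> d \<le> ?z \<bullet> p" if "d \<in> X" for d
      proof (cases "d \<in> F")
        case True
        then show ?thesis using const[OF True] by (simp add: inner_add_left inner_diff_left)
      next
        case False
        then have "\<epsilon> * \<bar>(u - v) \<bullet> (p - d)\<bar> \<le> u \<bullet> (p - d)" using \<epsilon>(2) that by blast
        moreover have "- (\<epsilon> * ((u - v) \<bullet> (p - d))) \<le> \<epsilon> * \<bar>(u - v) \<bullet> (p - d)\<bar>"
          using \<epsilon>(1) by (metis abs_ge_minus_self abs_mult abs_of_pos)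
        ultimately have "0 \<le> ?z \<bullet> (p - d)"
          unfolding z by (simp add: inner_add_left)
        then show ?thesis by (simp add: inner_diff_right)
      qed
      have "P \<subseteq> {y. ?z \<bullet> y \<le> ?z \<bullet> p}"
        unfolding X(2) using le by (intro hull_minimal convex_halfspace_le) auto
      moreover have "?z \<bullet> x = ?z \<bullet> p" if "x \<in> F" for x
        using const[OF that] by (simp add: inner_add_left inner_diff_left)
      moreover have "?z \<in> V"
        using u v V by (intro subspace_add subspace_scale) (auto simp: ncone_def)
      ultimately have "?z \<in> ?N" by (auto simp: ncone_def)
      then show "\<exists>e>1. (1 - e) *\<^sub>R v + e *\<^sub>R u \<in> ?N"
        using \<epsilon>(1) by (intro exI[of _ "1 + \<epsilon>"]) auto
    qed
  }
qed

section \<open>Polar duality\<close>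

lemma centered_iff_ball:
  assumes "subspace V"
  shows "centered V P \<longleftrightarrow> P \<subseteq> V \<and> (\<exists>e>0. ball 0 e \<inter> V \<subseteq> P)"
proof -
  have "0 \<in> top_of_set V interior_of P \<longleftrightarrow> (\<exists>e>0. ball 0 e \<inter> V \<subseteq> P)"
  proof
    assume "0 \<in> top_of_set V interior_of P"
    then obtain T where T: "openin (top_of_set V) T" "0 \<in> T" "T \<subseteq> P"
      by (auto simp: interior_of_def)
    then obtain e where "e > 0" "ball 0 e \<inter> V \<subseteq> T"
      unfolding openin_contains_ball by blast
    with T(3) show "\<exists>e>0. ball 0 e \<inter> V \<subseteq> P" by blast
  next
    assume "\<exists>e>0. ball 0 e \<inter> V \<subseteq> P"
    then obtain e where e: "e > 0" "ball 0 e \<inter> V \<subseteq> P" by blast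
    have "openin (top_of_set V) (V \<inter> ball 0 e)"
      by (simp add: openin_open_Int)
    moreover have "0 \<in> V \<inter> ball 0 e"
      using e(1) subspace_0[OF assms] by simp
    ultimately show "0 \<in> top_of_set V interior_of P"
      using e(2) unfolding interior_of_def by blast
  qed
  then show ?thesis by (simp add: centered_def)
qed

lemma centered_ballE:
  assumes "subspace V" "centered V P"
  obtains e where "e > 0" "ball 0 e \<inter> V \<subseteq> P"
  using iffD1[OF centered_iff_ball[OF assms(1)] assms(2)] by (elim conjE exE) (rule that)

lemma centered_imp_subset: "centered V P \<Longrightarrow> P \<subseteq> V"
  by (simp add: centered_def)

lemma centered_imp_affine_hull:
  assumes "subspace V" "centered V P"
  shows "affine hull P = V"
proof -
  obtain e where e: "e > 0" "ball 0 e \<inter> V \<subseteq> P"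
    using centered_ballE[OF assms] .
  have PV: "P \<subseteq> V" using assms(2) by (rule centered_imp_subset)
  have "affine hull (V \<inter> ball 0 e) = affine hull V"
    using subspace_imp_convex[OF assms(1)] open_ball
  proof (rule affine_hull_convex_Int_open)
    show "V \<inter> ball 0 e \<noteq> {}" using subspace_0[OF assms(1)] e(1) by force
  qed
  moreover have "affine hull V = V"
    using assms(1) by (simp only: affine_hull_eq subspace_imp_affine)
  moreover have "affine hull (V \<inter> ball 0 e) \<subseteq> affine hull P"
    using e by (intro hull_mono) auto
  moreover have "affine hull P \<subseteq> affine hull V"
    using PV by (rule hull_mono)
  ultimately show ?thesis by (metis subset_antisym)
qed

lemma centered_iff_rel_interior:
  assumes "subspace V"
  shows "centered V P \<longleftrightarrow> affine hull P = V \<and> 0 \<in> rel_interior P"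
proof
  assume P: "centered V P"
  then have aff: "affine hull P = V" by (rule centered_imp_affine_hull[OF assms])
  obtain e where e: "e > 0" "ball 0 e \<inter> V \<subseteq> P"
    using centered_ballE[OF assms P] .
  have "0 \<in> P" using e subspace_0[OF assms] by (meson IntI centre_in_ball subsetD)
  with e aff show "affine hull P = V \<and> 0 \<in> rel_interior P"
    unfolding mem_rel_interior_ball by (intro conjI exI[of _ e]) simp_all
next
  assume P: "affine hull P = V \<and> 0 \<in> rel_interior P"
  then have "P \<subseteq> V" using hull_subset[of P affine] by simp
  with P show "centered V P"
    unfolding centered_iff_ball[OF assms] mem_rel_interior_ball by auto
qed

lemma zero_in_centered: "subspace V \<Longrightarrow> centered V P \<Longrightarrow> 0 \<in> P"
  using centered_iff_rel_interior[of V P] rel_interior_subset[of P] by auto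

lemma centered_positive_direction:
  assumes "subspace V" "centered V P" "u \<in> V" "u \<noteq> 0"
  obtains p where "p \<in> P" "u \<bullet> p > 0"
proof -
  obtain e where e: "e > 0" "ball 0 e \<inter> V \<subseteq> P"
    using centered_ballE[OF assms(1,2)] .
  let ?p = "(e / (2 * norm u)) *\<^sub>R u"
  have "norm ?p < e" using e assms by simp
  then have "?p \<in> P" using e assms by (auto intro: subspace_scale)
  moreover have "u \<bullet> ?p > 0" using e assms by (simp add: zero_less_divide_iff)
  ultimately show thesis using that by blast
qed

lemma polar_subset: "polar V P \<subseteq> V"
  by (auto simp: polar_def)

lemma polar_convex_hull:
  "polar V (convex hull X) = polar V X"
proof -
  have "x \<in> polar V (convex hull X)" if "x \<in> polar V X" for x
  proof -
    have "X \<subseteq> {p. x \<bullet> p \<le> 1}" using that by (auto simp: polar_def)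
    then have "convex hull X \<subseteq> {p. x \<bullet> p \<le> 1}"
      by (intro hull_minimal convex_halfspace_le)
    with that show ?thesis by (auto simp: polar_def)
  qed
  moreover have "polar V (convex hull X) \<subseteq> polar V X"
    using hull_subset[of X convex] by (auto simp: polar_def)
  ultimately show ?thesis by blast
qed

lemma centered_polar:
  assumes "subspace V" "bounded P"
  shows "centered V (polar V P)"
proof -
  obtain B where B: "B > 0" "\<And>p. p \<in> P \<Longrightarrow> norm p \<le> B"
    using assms(2) by (meson bounded_pos)
  have "x \<in> polar V P" if "x \<in> ball 0 (1 / B) \<inter> V" for x
  proof -
    have "x \<bullet> p \<le> 1" if "p \<in> P" for p
    proof -
      have "x \<bullet> p \<le> norm x * norm p" by (rule norm_cauchy_schwarz)
      also have "\<dots> \<le> 1 / B * B"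
        using \<open>x \<in> ball 0 (1 / B) \<inter> V\<close> B(2)[OF that] B(1) by (intro mult_mono) auto
      finally show ?thesis using B(1) by simp
    qed
    then show ?thesis using that by (simp add: polar_def)
  qed
  then show ?thesis
    using B(1) by (auto simp: centered_iff_ball[OF assms(1)] polar_subset intro!: exI[of _ "1 / B"])
qed

text \<open>Testing \<open>x\<close> against the point of \<open>P\<close> at distance
  \<open>e / 2\<close> from the origin in the direction of \<open>x\<close> itself bounds its norm
  by \<open>2 / e\<close>.\<close>

lemma bounded_polar:
  assumes "subspace V" "centered V P"
  shows "bounded (polar V P)"
proof -
  obtain e where e: "e > 0" "ball 0 e \<inter> V \<subseteq> P"
    using centered_ballE[OF assms(1,2)] .
  have "norm x \<le> 2 / e" if x: "x \<in> polar V P" for x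
  proof (cases "x = 0")
    case False
    let ?p = "(e / (2 * norm x)) *\<^sub>R x"
    have "norm ?p < e" using e False by simp
    moreover have "?p \<in> V" using x assms(1) by (auto simp: polar_def intro: subspace_scale)
    ultimately have "?p \<in> P" using e(2) by auto
    then have "x \<bullet> ?p \<le> 1" using x unfolding polar_def by blast
    moreover have "x \<bullet> ?p = e / 2 * norm x"
      using False by (simp add: dot_square_norm power2_eq_square)
    ultimately have "e / 2 * norm x \<le> 1" by argo
    then show ?thesis using e(1) by (simp add: field_simps)
  qed (use e in simp)
  then show ?thesis by (auto simp: bounded_iff)
qed

text \<open>The finitely many generators of \<open>P\<close> already impose all inequalities of the
  polar, which is thus a bounded polyhedron.\<close>

lemma polytope_polar:
  assumes "subspace V" "centered V P" "polytope P"
  shows "polytope (polar V P)"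
proof -
  obtain X where X: "finite X" "P = convex hull X"
    using assms(3) by (auto simp: polytope_def)
  have "polar V P = V \<inter> \<Inter>((\<lambda>p. {x. p \<bullet> x \<le> 1}) ` X)"
    unfolding X(2) polar_convex_hull by (auto simp: polar_def inner_commute)
  moreover have "polyhedron \<dots>"
  proof (rule polyhedron_Int)
    show "polyhedron V"
      using assms(1) by (intro affine_imp_polyhedron subspace_imp_affine)
    show "polyhedron (\<Inter>((\<lambda>p. {x. p \<bullet> x \<le> 1}) ` X))"
      using X(1) by (intro polyhedron_Inter) (auto simp: polyhedron_halfspace_le)
  qed
  ultimately have "polyhedron (polar V P)" by simp
  then show ?thesis
    by (simp add: polytope_eq_bounded_polyhedron bounded_polar[OF assms(1,2)])
qed

lemma polar_polar:
  assumes V: "subspace V" and P: "centered V P" "closed P" "convex P"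
  shows "polar V (polar V P) = P"
proof (intro equalityI subsetI)
  fix y assume y: "y \<in> polar V (polar V P)"
  show "y \<in> P"
  proof (rule ccontr)
    assume "y \<notin> P"
    then obtain a b where ab: "a \<bullet> y < b" "\<And>p. p \<in> P \<Longrightarrow> a \<bullet> p > b"
      using separating_hyperplane_closed_point[OF P(3,2)] by metis
    obtain v where v: "v \<in> V" "\<And>x. x \<in> V \<Longrightarrow> v \<bullet> x = a \<bullet> x"
      using subspace_inner_representative[OF V] by metis
    have PV: "P \<subseteq> V" using P by (simp add: centered_def)
    \<comment> \<open>The origin lies in \<open>P\<close>, on the side opposite to \<open>y\<close>.
      Dividing by the negative \<open>b\<close> turns \<open>a \<bullet> p > b\<close> into the
      inequality that defines the polar.\<close>
    have b: "b < 0" using ab(2)[OF zero_in_centered[OF V P(1)]] by simp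
    have "(1 / b) *\<^sub>R v \<in> polar V P"
      using v PV ab(2) b V by (auto simp: polar_def subset_iff subspace_scale field_simps less_imp_le)
    then have "y \<bullet> ((1 / b) *\<^sub>R v) \<le> 1" using y unfolding polar_def by blast
    moreover have "y \<in> V" using y by (simp add: polar_def)
    ultimately have "a \<bullet> y / b \<le> 1"
      using v(2)[of y] by (simp add: inner_commute[of y])
    then have "a \<bullet> y \<ge> b" using b by (simp add: field_simps)
    with ab(1) show False by simp
  qed
next
  fix y assume "y \<in> P"
  then show "y \<in> polar V (polar V P)"
    using P by (auto simp: polar_def centered_def inner_commute)
qed

text \<open>The conjugate face of polar duality. For \<open>F = {}\<close> the condition is vacuous
  and gives the whole polar; for \<open>F = P\<close> it fails at the origin and gives the empty
  face. So both improper faces fit the order reversal.\<close>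

definition dual_face :: "'a::euclidean_space set \<Rightarrow> 'a set \<Rightarrow> 'a set \<Rightarrow> 'a set" where
  "dual_face V P F = {x \<in> polar V P. \<forall>y\<in>F. x \<bullet> y = 1}"

lemma dual_face_antimono: "F \<subseteq> G \<Longrightarrow> dual_face V P G \<subseteq> dual_face V P F"
  by (auto simp: dual_face_def)

lemma dual_face_empty [simp]: "dual_face V P {} = polar V P"
  by (simp add: dual_face_def)

lemma convex_polar:
  assumes "subspace V"
  shows "convex (polar V P)"
proof -
  have "polar V P = V \<inter> (\<Inter>p\<in>P. {x. p \<bullet> x \<le> 1})"
    by (auto simp: polar_def inner_commute)
  then show ?thesis
    using assms by (simp add: subspace_imp_convex convex_Int convex_INT convex_halfspace_le)
qed

lemma dual_face_face_of:
  assumes "subspace V" "F \<subseteq> P"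
  shows "dual_face V P F face_of polar V P"
proof (cases "F = {}")
  case True
  then show ?thesis using convex_polar[OF assms(1)] by (simp add: face_of_refl)
next
  case False
  have "dual_face V P F = \<Inter>((\<lambda>y. polar V P \<inter> {x. y \<bullet> x = 1}) ` F)"
    using False by (auto simp: dual_face_def inner_commute)
  moreover have "\<dots> face_of polar V P"
  proof (rule face_of_Inter)
    show "T face_of polar V P" if "T \<in> (\<lambda>y. polar V P \<inter> {x. y \<bullet> x = 1}) ` F" for T
    proof -
      from that obtain y where y: "y \<in> F" "T = polar V P \<inter> {x. y \<bullet> x = 1}" by (elim imageE)
      show ?thesis
        unfolding y(2) using y(1) assms
        by (intro face_of_Int_supporting_hyperplane_le convex_polar)
          (auto simp: polar_def inner_commute[of y])
    qed
  qed (use False in simp)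
  ultimately show ?thesis by simp
qed

lemma dual_face_self:
  assumes "0 \<in> F"
  shows "dual_face V P F = {}"
proof -
  have "\<not> (\<forall>y\<in>F. x \<bullet> y = 1)" for x
    using assms by (metis inner_zero_right zero_neq_one)
  then show ?thesis by (simp add: dual_face_def)
qed

text \<open>A functional exposing a proper nonempty face, scaled to have maximum 1, is itself a
  point of the dual face, and it is tight at no other point of \<open>P\<close>. Hence the dual face
  remembers \<open>F\<close>.\<close>

lemma dual_face_dual_face:
  assumes V: "subspace V" and P: "centered V P" "polytope P" and F: "F face_of P"
  shows "dual_face V (polar V P) (dual_face V P F) = F"
proof -
  have pp: "polar V (polar V P) = P"
    using V P by (simp add: polar_polar polytope_imp_closed polytope_imp_convex)
  have zP: "0 \<in> P" using zero_in_centered[OF V P(1)] .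
  have zR: "0 \<in> polar V P"
    using V by (simp add: polar_def subspace_0)
  have FP: "F \<subseteq> P" using F by (rule face_of_imp_subset)
  show ?thesis
  proof (cases "F = {} \<or> F = P")
    case True
    then show ?thesis
      by (elim disjE) (simp_all add: dual_face_self zP zR pp)
  next
    case False
    have PV: "P \<subseteq> V" using P by (simp add: centered_def)
    obtain u where u: "u \<in> V" "argmax_face u P = F"
      using face_eq_argmax_face[OF P(2) F _ V PV] False by metis
    obtain q where q: "q \<in> F" using False by blast
    have Feq: "F = P \<inter> {y. u \<bullet> y = u \<bullet> q}" using argmax_face_eq[of q u P] q u by simp
    \<comment> \<open>A proper face misses the relative interior, where the origin lies. This makes
      the maximum of \<open>u\<close> strictly positive, so that it can be scaled to 1.\<close>
    have "0 \<notin> F"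
      using face_of_disjoint_rel_interior[OF F] False iffD1[OF centered_iff_rel_interior[OF V] P(1)] by blast
    moreover have le: "u \<bullet> y \<le> u \<bullet> q" if "y \<in> P" for y
      using that q u(2) by (auto simp: argmax_face_def)
    ultimately have pos: "u \<bullet> q > 0"
      using zP le[OF zP] Feq by (auto simp: less_le)
    define w where "w = (1 / (u \<bullet> q)) *\<^sub>R u"
    have "w \<in> dual_face V P F"
      using u(1) V pos le Feq by (auto simp: w_def dual_face_def polar_def subspace_scale)
    moreover have "y \<in> F" if "y \<in> P" "w \<bullet> y = 1" for y
      using that pos Feq by (simp add: w_def field_simps)
    ultimately have "dual_face V (polar V P) (dual_face V P F) \<subseteq> F"
      unfolding dual_face_def[of V "polar V P"] pp by (auto simp: inner_commute)
    moreover have "F \<subseteq> dual_face V (polar V P) (dual_face V P F)"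
      unfolding dual_face_def[of V "polar V P"] pp using FP
      by (auto simp: dual_face_def inner_commute)
    ultimately show ?thesis by blast
  qed
qed

lemma dual_face_subset_iff:
  assumes "subspace V" "centered V P" "polytope P" "F face_of P" "G face_of P"
  shows "dual_face V P F \<subseteq> dual_face V P G \<longleftrightarrow> G \<subseteq> F"
  using assms dual_face_dual_face dual_face_antimono by metis

lemma dual_face_surj:
  assumes V: "subspace V" and P: "centered V P" "polytope P" and H: "H face_of polar V P"
  obtains F where "F face_of P" "dual_face V P F = H"
proof -
  have pp: "polar V (polar V P) = P"
    using V P by (simp add: polar_polar polytope_imp_closed polytope_imp_convex)
  have R: "centered V (polar V P)" "polytope (polar V P)"
    using V P by (simp_all add: centered_polar polytope_polar polytope_imp_bounded)
  have "dual_face V (polar V P) H face_of P"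
    using dual_face_face_of[OF V face_of_imp_subset[OF H]] pp by simp
  moreover have "dual_face V P (dual_face V (polar V P) H) = H"
    using dual_face_dual_face[OF V R H] pp by simp
  ultimately show thesis using that by blast
qed

text \<open>The constraints tight at a point determine the smallest face containing it. A constraint
  tight at a relative interior point of \<open>F\<close> cuts out a face of \<open>F\<close> through
  that point, hence all of \<open>F\<close>. Conversely, a point on the relative frontier lies in a
  facet \<open>G\<close> of \<open>F\<close>, and the constraints tight on \<open>G\<close> would
  all be tight on \<open>F\<close>, contradicting the injectivity of duality.\<close>

lemma rel_interior_face_iff_dual_face:
  assumes V: "subspace V" and P: "centered V P" "polytope P" and F: "F face_of P" "F \<noteq> {}"
  shows "u \<in> rel_interior F \<longleftrightarrow> u \<in> P \<and> {x \<in> polar V P. x \<bullet> u = 1} = dual_face V P F"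
proof
  have FP: "F \<subseteq> P" using F by (simp add: face_of_imp_subset)
  {
    assume u: "u \<in> rel_interior F"
    then have uF: "u \<in> F" using rel_interior_subset by blast
    have "x \<bullet> y = 1" if x: "x \<in> polar V P" "x \<bullet> u = 1" and "y \<in> F" for x y
    proof -
      have "F \<inter> {y. x \<bullet> y = 1} face_of F"
        using x FP F by (intro face_of_Int_supporting_hyperplane_le)
          (auto simp: polar_def face_of_imp_convex)
      moreover have "u \<in> (F \<inter> {y. x \<bullet> y = 1}) \<inter> rel_interior F" using u uF x by simp
      ultimately have "F \<inter> {y. x \<bullet> y = 1} = F"
        using face_of_disjoint_rel_interior by blast
      with \<open>y \<in> F\<close> show ?thesis by blast
    qed
    with uF FP show "u \<in> P \<and> {x \<in> polar V P. x \<bullet> u = 1} = dual_face V P F"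
      by (auto simp: dual_face_def)
  }
  {
    assume u: "u \<in> P \<and> {x \<in> polar V P. x \<bullet> u = 1} = dual_face V P F"
    have poly: "polytope F" using P F face_of_polytope_polytope by blast
    have "u \<in> dual_face V (polar V P) (dual_face V P F)"
      using u P V by (auto simp: dual_face_def[of V "polar V P"] polar_polar polytope_imp_closed
          polytope_imp_convex inner_commute)
    then have uF: "u \<in> F" using dual_face_dual_face[OF V P F(1)] by simp
    show "u \<in> rel_interior F"
    proof (rule ccontr)
      assume "u \<notin> rel_interior F"
      then have "u \<in> rel_frontier F"
        using uF closure_subset by (auto simp: rel_frontier_def)
      then obtain G where G: "G facet_of F" "u \<in> G"
        using rel_frontier_of_polyhedron[OF polytope_imp_polyhedron[OF poly]] by blast
      then have GP: "G face_of P" using F face_of_trans facet_of_imp_face_of by blast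
      have "dual_face V P G \<subseteq> dual_face V P F"
        using u G(2) by (auto simp: dual_face_def)
      then have "F \<subseteq> G" using dual_face_subset_iff[OF V P GP F(1)] by simp
      then have "G = F" using G facet_of_imp_subset by blast
      with G(1) show False by simp
    qed
  }
qed

section \<open>Convex hulls of two parallel polytopes\<close>

text \<open>The Cayley polytope of \<open>P\<close> and \<open>R\<close>. Both sets share the same
  directions; it is their relative position that decides which pairs of faces span a face.\<close>

definition join_hull :: "'a::euclidean_space set \<Rightarrow> 'a set \<Rightarrow> ('a \<times> real) set" where
  "join_hull P R = convex hull (P \<times> {0} \<union> R \<times> {1})"

text \<open>In a convex combination of nonnegative heights with sum 0, every term of positive weight
  has height 0. The auxiliary set \<open>?S\<close> packages this as a convexity statement, so that
  minimality of the hull applies.\<close>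

lemma join_hull_0_iff:
  assumes "convex P"
  shows "(x, 0) \<in> join_hull P R \<longleftrightarrow> x \<in> P"
proof
  let ?S = "{z. snd z \<ge> 0 \<and> (snd z = 0 \<longrightarrow> fst z \<in> P)} :: ('a \<times> real) set"
  have "convex ?S"
  proof (rule convexI)
    fix y z :: "'a \<times> real" and a b :: real
    assume yz: "y \<in> ?S" "z \<in> ?S" and ab: "0 \<le> a" "0 \<le> b" "a + b = 1"
    have "fst (a *\<^sub>R y + b *\<^sub>R z) \<in> P" if "snd (a *\<^sub>R y + b *\<^sub>R z) = 0"
    proof -
      have "a * snd y \<ge> 0" "b * snd z \<ge> 0" using yz ab by auto
      then have "a * snd y = 0" "b * snd z = 0" using that by (simp_all add: add_nonneg_eq_0_iff)
      then consider "a = 0" "b = 1" "snd z = 0" | "b = 0" "a = 1" "snd y = 0" | "snd y = 0" "snd z = 0"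
        using ab by fastforce
      then show ?thesis
        using yz ab assms by cases (auto simp: convexD)
    qed
    then show "a *\<^sub>R y + b *\<^sub>R z \<in> ?S" using yz ab by auto
  qed
  then have "join_hull P R \<subseteq> ?S"
    unfolding join_hull_def by (intro hull_minimal) auto
  then show "(x, 0) \<in> join_hull P R \<Longrightarrow> x \<in> P" by auto
  show "x \<in> P \<Longrightarrow> (x, 0) \<in> join_hull P R"
    unfolding join_hull_def by (rule hull_inc) simp
qed

text \<open>Reflecting the height by \<open>t \<mapsto> 1 - t\<close> exchanges the two ends. The
  reflection is split into a linear map and a translation, with each of which convex hulls
  commute.\<close>

lemma join_hull_1_iff:
  assumes "convex R"
  shows "(x, 1) \<in> join_hull P R \<longleftrightarrow> x \<in> R"
proof -
  let ?g = "\<lambda>z :: 'a \<times> real. (fst z, - snd z)"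
  let ?f = "\<lambda>z :: 'a \<times> real. (0, 1) + (fst z, - snd z)"
  have lin: "linear ?g"
    by (auto intro!: linearI simp: plus_prod_def scaleR_prod_def)
  have f: "?f ` X = (+) (0, 1) ` (?g ` X)" for X
    by (simp add: image_image)
  have "?f ` join_hull R P = convex hull (?f ` (R \<times> {0} \<union> P \<times> {1}))"
    unfolding join_hull_def f convex_hull_linear_image[OF lin] convex_hull_translation ..
  also have "?f ` (R \<times> {0} \<union> P \<times> {1}) = P \<times> {0} \<union> R \<times> {1}"
    by (force simp: image_iff)
  finally have "?f ` join_hull R P = join_hull P R"
    by (simp add: join_hull_def)
  moreover have "(x, 1) \<in> ?f ` join_hull R P \<longleftrightarrow> (x, 0) \<in> join_hull R P"
    by (force simp: image_iff)
  ultimately show ?thesis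
    using join_hull_0_iff[OF assms] by blast
qed

lemma polytope_join_hull:
  assumes "polytope P" "polytope R"
  shows "polytope (join_hull P R)"
proof -
  obtain X Y where X: "finite X" "P = convex hull X" and Y: "finite Y" "R = convex hull Y"
    using assms by (auto simp: polytope_def)
  have times: "(convex hull Z) \<times> {c} = convex hull (Z \<times> {c})" for Z :: "'a set" and c :: real
    by (simp add: convex_hull_Times)
  have "join_hull P R = convex hull (X \<times> {0} \<union> Y \<times> {1})"
    unfolding join_hull_def X(2) Y(2) times by (rule hull_Un[symmetric]) (rule convex_Inter, blast)
  then show ?thesis using X(1) Y(1) by (simp add: polytope_convex_hull)
qed

lemma join_hull_mono: "G \<subseteq> P \<Longrightarrow> H \<subseteq> R \<Longrightarrow> join_hull G H \<subseteq> join_hull P R"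
  unfolding join_hull_def by (intro hull_mono) auto

text \<open>A face of the hull of a compact set is the hull of some of its generators, and all
  generators have height 0 or 1. A face is therefore recovered from its two end slices.\<close>

lemma face_of_join_hull_eq:
  assumes "compact P" "compact R" "F face_of join_hull P R"
  shows "F = join_hull {x. (x, 0) \<in> F} {x. (x, 1) \<in> F}"
proof
  have "compact (P \<times> {0} \<union> R \<times> {1::real})"
    using assms by (intro compact_Un compact_Times) auto
  then obtain S where S: "S \<subseteq> P \<times> {0} \<union> R \<times> {1}" "F = convex hull S"
    using assms(3) face_of_convex_hull_subset unfolding join_hull_def by metis
  have "S \<subseteq> F" unfolding S(2) by (rule hull_subset)
  then show "F \<subseteq> join_hull {x. (x, 0) \<in> F} {x. (x, 1) \<in> F}"
    using S(1) unfolding join_hull_def by (subst S(2), intro hull_mono) auto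
  show "join_hull {x. (x, 0) \<in> F} {x. (x, 1) \<in> F} \<subseteq> F"
    unfolding join_hull_def
    using face_of_imp_convex[OF assms(3)] by (intro hull_minimal) auto
qed

lemma face_of_join_hullI:
  assumes PR: "compact P" "convex P" "compact R" "convex R"
    and GH: "argmax_face u P = G" "argmax_face u R = H" "G \<noteq> {}" "H \<noteq> {}"
  shows "join_hull G H face_of join_hull P R"
proof -
  obtain x y where xy: "x \<in> G" "y \<in> H" using GH by blast
  have G: "G = P \<inter> {z. u \<bullet> z = u \<bullet> x}" using argmax_face_eq[of x u P] xy GH by simp
  have H: "H = R \<inter> {z. u \<bullet> z = u \<bullet> y}" using argmax_face_eq[of y u R] xy GH by simp
  \<comment> \<open>The last coordinate is the offset that lifts the maximum over \<open>R\<close>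
    to the level of the maximum over \<open>P\<close>.\<close>
  let ?w = "(u, u \<bullet> x - u \<bullet> y)"
  have "join_hull P R \<subseteq> {z. ?w \<bullet> z \<le> u \<bullet> x}"
    unfolding join_hull_def
    using xy GH by (intro hull_minimal convex_halfspace_le) (auto simp: argmax_face_def)
  moreover have "convex (join_hull P R)" by (simp add: join_hull_def)
  ultimately have F: "join_hull P R \<inter> {z. ?w \<bullet> z = u \<bullet> x} face_of join_hull P R" (is "?F face_of _")
    by (intro face_of_Int_supporting_hyperplane_le) auto
  have "{z. (z, 0) \<in> ?F} = G" using PR by (auto simp: join_hull_0_iff G)
  moreover have "{z. (z, 1) \<in> ?F} = H" using PR by (auto simp: join_hull_1_iff H)
  ultimately show ?thesis
    using face_of_join_hull_eq[OF PR(1,3) F] F by simp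
qed

text \<open>On each end the last coordinate of an exposing functional contributes only a constant.
  As both ends of the face are nonempty, the common maximum is attained on both, so the first
  component alone exposes \<open>G\<close> in \<open>P\<close> and \<open>H\<close> in
  \<open>R\<close>.\<close>

lemma face_of_join_hullD:
  assumes PR: "polytope P" "polytope R"
    and GH: "convex G" "convex H" "G \<noteq> {}" "H \<noteq> {}" "join_hull G H face_of join_hull P R"
  obtains u where "argmax_face u P = G" "argmax_face u R = H"
proof -
  obtain x y where xy: "x \<in> G" "y \<in> H" using GH by blast
  have mem: "(x, 0) \<in> join_hull G H" "(y, 1) \<in> join_hull G H"
    using xy GH by (simp_all add: join_hull_0_iff join_hull_1_iff)
  have conv: "convex P" "convex R" using PR by (simp_all add: polytope_imp_convex)
  obtain w where w: "argmax_face w (join_hull P R) = join_hull G H"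
    using face_eq_argmax_face[OF polytope_join_hull[OF PR] GH(5), of UNIV] mem by auto
  obtain u t where ut: "w = (u, t)" by force
  have z0: "z \<in> G \<longleftrightarrow> (z, 0) \<in> argmax_face w (join_hull P R)" for z
    using w GH by (simp add: join_hull_0_iff)
  have z1: "z \<in> H \<longleftrightarrow> (z, 1) \<in> argmax_face w (join_hull P R)" for z
    using w GH by (simp add: join_hull_1_iff)
  have le: "w \<bullet> z \<le> w \<bullet> (x, 0)" "w \<bullet> z \<le> w \<bullet> (y, 1)" if "z \<in> join_hull P R" for z
    using mem that unfolding w[symmetric] by (auto simp: argmax_face_def)
  have G: "z \<in> G \<longleftrightarrow> z \<in> P \<and> u \<bullet> z = u \<bullet> x" for z
    unfolding z0 argmax_face_eq[OF mem(1)[folded w]]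
    using conv by (auto simp: ut join_hull_0_iff)
  have H: "z \<in> H \<longleftrightarrow> z \<in> R \<and> u \<bullet> z = u \<bullet> y" for z
    unfolding z1 argmax_face_eq[OF mem(2)[folded w]]
    using conv by (auto simp: ut join_hull_1_iff)
  have leP: "u \<bullet> z \<le> u \<bullet> x" if "z \<in> P" for z
    using le(1)[of "(z, 0)"] that conv by (simp add: ut join_hull_0_iff)
  have leR: "u \<bullet> z \<le> u \<bullet> y" if "z \<in> R" for z
    using le(2)[of "(z, 1)"] that conv by (simp add: ut join_hull_1_iff)
  have "x \<in> argmax_face u P" "y \<in> argmax_face u R"
    using leP leR xy G H by (auto simp: argmax_face_def)
  from argmax_face_eq[OF this(1)] argmax_face_eq[OF this(2)]
  have "argmax_face u P = G" "argmax_face u R = H" using G H by auto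
  then show thesis using that by blast
qed

text \<open>The bridge between balanced pairs and faces of the hull. \<open>F \<noteq> P'\<close>
  makes the dual face nonempty, so the criterion with two nonempty ends applies;
  \<open>F \<noteq> {}\<close> makes it proper, so a functional exposing it in the polar is nonzero
  and can be normalized.\<close>

lemma normal_cone_meets_face_iff:
  assumes V: "subspace V"
    and P: "polytope P" "P \<subseteq> V" and P': "polytope P'" "centered V P'"
    and G: "G face_of P" "G \<noteq> {}" and F: "F face_of P'" "F \<noteq> {}" "F \<noteq> P'"
  shows "rel_interior (ncone V P G) \<inter> rel_interior F \<noteq> {} \<longleftrightarrow>
    join_hull G (dual_face V P' F) face_of join_hull P (polar V P')"
proof -
  let ?R = "polar V P'" and ?H = "dual_face V P' F"
  have cR: "centered V ?R" using V P'(1) by (simp add: centered_polar polytope_imp_bounded)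
  have R: "polytope ?R" using polytope_polar[OF V P'(2,1)] .
  have pp: "polar V ?R = P'"
    using V P' by (simp add: polar_polar polytope_imp_closed polytope_imp_convex)
  have RV: "?R \<subseteq> V" by (rule polar_subset)
  have "P' face_of P'" using P' by (simp add: face_of_refl polytope_imp_convex)
  then have "?H \<noteq> {}"
    using dual_face_dual_face[OF V P'(2,1)] F(1,3) dual_face_self[OF zero_in_centered[OF V P'(2)]]
    by metis
  have HR: "?H \<noteq> ?R"
    using dual_face_dual_face[OF V P'(2,1)] F(1,2) dual_face_empty empty_face_of by metis
  note ri = rel_interior_ncone[OF P(1) G V P(2)] rel_interior_face_iff_dual_face[OF V P'(2,1) F(1,2)]
  show ?thesis
  proof
    assume "rel_interior (ncone V P G) \<inter> rel_interior F \<noteq> {}"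
    then obtain u where "u \<in> rel_interior (ncone V P G)" "u \<in> rel_interior F" by blast
    then have u: "u \<in> V" "argmax_face u P = G" "u \<in> P'" "{x \<in> ?R. x \<bullet> u = 1} = ?H"
      using ri by blast+
    have le: "u \<bullet> x \<le> 1" if "x \<in> ?R" for x
      using that u(3) by (simp add: polar_def inner_commute)
    obtain y where y: "y \<in> ?H" using \<open>?H \<noteq> {}\<close> by blast
    then have uy: "y \<in> ?R" "u \<bullet> y = 1" using u(4) by (auto simp: inner_commute)
    then have "y \<in> argmax_face u ?R" using le by (simp add: argmax_face_def)
    then have "argmax_face u ?R = ?H"
      using argmax_face_eq[of y u ?R] uy u(4) by (auto simp: inner_commute)
    then show "join_hull G ?H face_of join_hull P ?R"
      using P(1) R u(2) G(2) \<open>?H \<noteq> {}\<close>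
      by (intro face_of_join_hullI) (auto intro: polytope_imp_compact polytope_imp_convex)
  next
    assume F': "join_hull G ?H face_of join_hull P ?R"
    have "convex ?H"
      using dual_face_face_of[OF V face_of_imp_subset[OF F(1)]] by (rule face_of_imp_convex)
    then obtain u where u: "argmax_face u P = G" "argmax_face u ?R = ?H"
      using face_of_join_hullD[OF P(1) R face_of_imp_convex[OF G(1)] _ G(2) \<open>?H \<noteq> {}\<close> F'] by metis
    obtain v where v: "v \<in> V" "\<And>x. x \<in> V \<Longrightarrow> v \<bullet> x = u \<bullet> x"
      using subspace_inner_representative[OF V] by metis
    have vP: "argmax_face v P = G"
      unfolding u(1)[symmetric] by (intro argmax_face_cong v(2) subsetD[OF P(2)])
    have vR: "argmax_face v ?R = ?H"
      unfolding u(2)[symmetric] by (intro argmax_face_cong v(2) subsetD[OF RV])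
    have "v \<noteq> 0" using vR HR argmax_face_zero by metis
    then obtain p where p: "p \<in> ?R" "v \<bullet> p > 0"
      using centered_positive_direction[OF V cR v(1)] by metis
    obtain y where y: "y \<in> ?H" using \<open>?H \<noteq> {}\<close> by blast
    then have vy: "v \<bullet> x \<le> v \<bullet> y" if "x \<in> ?R" for x
      using that vR by (auto simp: argmax_face_def)
    then have pos: "v \<bullet> y > 0" using p by (meson less_le_trans)
    \<comment> \<open>Scaling the maximum over the polar to 1 picks, on the ray of \<open>v\<close>,
      the point that lies in the bipolar \<open>P'\<close> and is tight exactly on
      \<open>?H\<close>.\<close>
    define w where "w = (1 / (v \<bullet> y)) *\<^sub>R v"
    have wV: "w \<in> V" using v V by (simp add: w_def subspace_scale)
    have w1: "w \<bullet> x \<le> 1" if "x \<in> ?R" for x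
      using vy[OF that] pos by (simp add: w_def)
    have "w \<in> polar V ?R" unfolding polar_def[of V ?R] using wV w1 by (intro CollectI conjI ballI)
    then have "w \<in> P'" using pp by simp
    moreover have "{x \<in> ?R. x \<bullet> w = 1} = ?H"
    proof -
      have "x \<bullet> w = 1 \<longleftrightarrow> v \<bullet> x = v \<bullet> y" for x
        using pos by (auto simp: w_def inner_commute[of x])
      then have "{x \<in> ?R. x \<bullet> w = 1} = ?R \<inter> {x. v \<bullet> x = v \<bullet> y}" by blast
      also have "\<dots> = argmax_face v ?R"
        using y unfolding vR[symmetric] by (rule argmax_face_eq[symmetric])
      finally show ?thesis unfolding vR .
    qed
    ultimately have wF: "w \<in> rel_interior F" unfolding ri(2) ..
    have "argmax_face w P = G" using vP pos by (simp add: w_def argmax_face_scaleR)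
    then have "w \<in> rel_interior (ncone V P G)" unfolding ri(1) using wV by simp
    with wF show "rel_interior (ncone V P G) \<inter> rel_interior F \<noteq> {}" by blast
  qed
qed

text \<open>This covers \<open>F = P'\<close>: exposing \<open>G\<close> does not depend on positive
  scaling, and a short vector lies in the interior of \<open>P'\<close> relative to
  \<open>V\<close>.\<close>

lemma normal_cone_meets_centered:
  assumes V: "subspace V"
    and P: "polytope P" "P \<subseteq> V" and P': "centered V P'"
    and G: "G face_of P" "G \<noteq> {}"
  shows "rel_interior (ncone V P G) \<inter> rel_interior P' \<noteq> {}"
proof -
  obtain u where u: "u \<in> V" "argmax_face u P = G"
    using face_eq_argmax_face[OF P(1) G V P(2)] by metis
  obtain e where e: "e > 0" "ball 0 e \<inter> V \<subseteq> P'"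
    using centered_ballE[OF V P'] .
  \<comment> \<open>The summand 1 in the denominator admits \<open>u = 0\<close>, which occurs for
    \<open>G = P\<close>.\<close>
  define w where "w = (e / (2 * (norm u + 1))) *\<^sub>R u"
  have c: "e / (2 * (norm u + 1)) > 0" using e(1) by (simp add: add_nonneg_pos)
  have nw: "norm w < e / 2"
  proof -
    have "norm w = (e / 2) * (norm u / (norm u + 1))"
      using e(1) by (simp add: w_def)
    also have "\<dots> < (e / 2) * 1"
      using e(1) by (intro mult_strict_left_mono) (simp_all add: add_nonneg_pos)
    finally show ?thesis by simp
  qed
  have wV: "w \<in> V" using u V by (simp add: w_def subspace_scale)
  have "ball w (e / 2) \<subseteq> ball 0 e"
  proof
    fix x assume "x \<in> ball w (e / 2)"
    then show "x \<in> ball 0 e"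
      using nw norm_triangle_ineq[of "x - w" w] by (simp add: dist_norm norm_minus_commute)
  qed
  then have sub: "ball w (e / 2) \<inter> V \<subseteq> P'" using e(2) by auto
  moreover have "w \<in> ball w (e / 2) \<inter> V" using wV e(1) by simp
  ultimately have "w \<in> P'" by (rule subsetD)
  with sub have "w \<in> rel_interior P'"
    unfolding mem_rel_interior_ball centered_imp_affine_hull[OF V P']
    using e(1) by (intro conjI exI[of _ "e / 2"]) auto
  moreover have "w \<in> rel_interior (ncone V P G)"
    unfolding rel_interior_ncone[OF P(1) G V P(2)]
    using u wV c by (simp add: w_def argmax_face_scaleR)
  ultimately show ?thesis by blast
qed

section \<open>Maps preserving segments\<close>

lemma aff_dim_le_strict_mono_faces:
  fixes P :: "'a::euclidean_space set" and P' :: "'b::euclidean_space set"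
  assumes P: "polytope P"
    and face: "\<And>F. F face_of P \<Longrightarrow> \<theta> F face_of P'"
    and mono: "\<And>F G. F face_of P \<Longrightarrow> G face_of P \<Longrightarrow> F \<subset> G \<Longrightarrow> \<theta> F \<subset> \<theta> G"
  shows "F face_of P \<Longrightarrow> aff_dim F \<le> aff_dim (\<theta> F)"
\<comment> \<open>The dimension of a face is the length of a chain of faces below it, and strict
  inclusions raise the dimension in the target as well. The shift by 1 accounts for the dimension -1
  of the empty face.\<close>
proof (induction "nat (aff_dim F + 1)" arbitrary: F rule: less_induct)
  case (less F)
  show ?case
  proof (cases "F = {}")
    case True
    then show ?thesis by (simp add: aff_dim_geq)
  next
    case False
    \<comment> \<open>Facets are nonempty by definition, so a point has none; its empty face has the
      required dimension -1.\<close>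
    have "\<exists>G. G face_of F \<and> aff_dim G = aff_dim F - 1"
    proof (cases "aff_dim F = 0")
      case True
      then show ?thesis by (intro exI[of _ "{}"]) simp
    next
      case pos: False
      then have "0 < aff_dim F" using False aff_dim_geq[of F] aff_dim_empty[of F] by linarith
      then obtain G where "G facet_of F"
        using polytope_facet_exists face_of_polytope_polytope[OF P less.prems] by blast
      then show ?thesis by (auto simp: facet_of_def)
    qed
    then obtain G where G: "G face_of F" "aff_dim G = aff_dim F - 1" by blast
    have GP: "G face_of P" using G(1) less.prems by (rule face_of_trans)
    have "aff_dim F \<ge> 0" using False aff_dim_geq[of F] aff_dim_empty[of F] by linarith
    then have IH: "aff_dim G \<le> aff_dim (\<theta> G)"
      using G(2) by (intro less.hyps[OF _ GP]) simp
    have "G \<subset> F" using G face_of_imp_subset by fastforce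
    then have sub: "\<theta> G \<subset> \<theta> F" by (rule mono[OF GP less.prems])
    then have "\<theta> G face_of \<theta> F"
      using face[OF GP] face[OF less.prems] by (meson face_of_imp_subset face_of_subset psubset_imp_subset)
    then have "aff_dim (\<theta> G) < aff_dim (\<theta> F)"
      using sub face_of_imp_convex[OF face[OF less.prems]] by (intro face_of_aff_dim_lt) auto
    with IH G(2) show ?thesis by linarith
  qed
qed

lemma poset_iso_inverse:
  assumes "poset_iso A le B le' \<phi>"
  shows "poset_iso B le' A le (inv_into A \<phi>)"
proof -
  have bij: "bij_betw \<phi> A B"
    and le: "\<And>x y. x \<in> A \<Longrightarrow> y \<in> A \<Longrightarrow> le x y \<longleftrightarrow> le' (\<phi> x) (\<phi> y)"
    using assms by (auto simp: poset_iso_def)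
  have bij': "bij_betw (inv_into A \<phi>) B A" using bij by (rule bij_betw_inv_into)
  have "le' x y \<longleftrightarrow> le (inv_into A \<phi> x) (inv_into A \<phi> y)" if "x \<in> B" "y \<in> B" for x y
    using that bij' le[of "inv_into A \<phi> x" "inv_into A \<phi> y"] bij_betw_inv_into_right[OF bij]
    by (simp add: bij_betw_apply)
  with bij' show ?thesis by (simp add: poset_iso_def)
qed

lemma aff_dim_le_face_lattice:
  assumes "polytope P" "convex P'"
    and iso: "face_lattice_iso A le P \<phi>" "face_lattice_iso A le P' \<phi>'"
  shows "aff_dim P \<le> aff_dim P'"
proof -
  let ?\<theta> = "\<lambda>F. \<phi>' (inv_into A \<phi> F)"
  have i1: "poset_iso {F. F face_of P} (\<subseteq>) A le (inv_into A \<phi>)"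
    using iso(1) unfolding face_lattice_iso_def by (rule poset_iso_inverse)
  have i2: "poset_iso A le {F. F face_of P'} (\<subseteq>) \<phi>'"
    using iso(2) by (simp add: face_lattice_iso_def)
  have inA: "inv_into A \<phi> F \<in> A" if "F face_of P" for F
    using i1 that by (auto simp: poset_iso_def bij_betw_def)
  have face: "?\<theta> F face_of P'" if "F face_of P" for F
    using i2 inA[OF that] by (auto simp: poset_iso_def bij_betw_def)
  have sub: "F \<subseteq> G \<longleftrightarrow> ?\<theta> F \<subseteq> ?\<theta> G" if "F face_of P" "G face_of P" for F G
    using i1 i2 inA that by (auto simp: poset_iso_def)
  have "P face_of P" using assms(1) by (simp add: face_of_refl polytope_imp_convex)
  then have "aff_dim P \<le> aff_dim (?\<theta> P)"
    using face sub by (intro aff_dim_le_strict_mono_faces[OF assms(1), of ?\<theta> P']) blast+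
  also have "\<dots> \<le> aff_dim P'"
    using face[OF \<open>P face_of P\<close>] by (intro aff_dim_subset face_of_imp_subset)
  finally show ?thesis .
qed

lemma aff_dim_eq_face_lattice:
  assumes "polytope P" "polytope P'" "face_lattice_iso A le P \<phi>" "face_lattice_iso A le P' \<phi>'"
  shows "aff_dim P = aff_dim P'"
  using assms by (intro antisym aff_dim_le_face_lattice) (auto intro: polytope_imp_convex)

text \<open>Just enough to transport convexity and faces, both of which are defined through open
  segments. It asks nothing about speed along a segment, so it holds for projective maps on sets
  where their denominators are positive.\<close>

definition preserves_segments ::
  "'a::euclidean_space set \<Rightarrow> ('a \<Rightarrow> 'b::euclidean_space) \<Rightarrow> bool" where
  "preserves_segments K T \<longleftrightarrow>
     inj_on T K \<and> (\<forall>a\<in>K. \<forall>b\<in>K. T ` open_segment a b = open_segment (T a) (T b))"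

lemma preserves_segments_projective:
  fixes M :: "'a::euclidean_space \<Rightarrow> 'b::euclidean_space" and s :: "'a \<Rightarrow> real"
  assumes K: "convex K"
    and M: "\<And>a b t. M ((1 - t) *\<^sub>R a + t *\<^sub>R b) = (1 - t) *\<^sub>R M a + t *\<^sub>R M b"
    and s: "\<And>a b t. s ((1 - t) *\<^sub>R a + t *\<^sub>R b) = (1 - t) * s a + t * s b"
    and pos: "\<And>x. x \<in> K \<Longrightarrow> s x > 0"
    and inj: "inj_on (\<lambda>x. (1 / s x) *\<^sub>R M x) K"
  shows "preserves_segments K (\<lambda>x. (1 / s x) *\<^sub>R M x)"
proof -
  let ?T = "\<lambda>x. (1 / s x) *\<^sub>R M x"
  have "?T ` open_segment a b = open_segment (?T a) (?T b)" if ab: "a \<in> K" "b \<in> K" for a b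
  proof (cases "a = b")
    case False
    then have neq: "?T a \<noteq> ?T b" using inj_onD[OF inj _ ab] by blast
    have sab: "s a > 0" "s b > 0" using ab pos by auto
    \<comment> \<open>A projective map distorts the parameter: the weight of \<open>b\<close>
      becomes proportional to \<open>u * s b\<close> and that of \<open>a\<close> to
      \<open>(1 - u) * s a\<close>. With \<open>s\<close> positive at both ends this is a bijection
      of the open unit interval.\<close>
    have T: "?T ((1 - u) *\<^sub>R a + u *\<^sub>R b) = (1 - v) *\<^sub>R ?T a + v *\<^sub>R ?T b"
      if u: "0 < u" "u < 1" and v: "v * ((1 - u) * s a + u * s b) = u * s b" for u v
    proof -
      let ?S = "(1 - u) * s a + u * s b"
      have S: "?S > 0" using u sab by (simp add: add_pos_pos)
      have v': "v = u * s b / ?S" using v S by (simp add: field_simps)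
      have "1 - v = (1 - u) * s a / ?S"
        unfolding v' using S by (simp add: field_simps)
      then show ?thesis
        unfolding M s v' using sab S by (simp add: scaleR_add_right)
    qed
    show ?thesis
    proof (intro equalityI subsetI)
      fix y assume "y \<in> ?T ` open_segment a b"
      then obtain u where u: "0 < u" "u < 1" "y = ?T ((1 - u) *\<^sub>R a + u *\<^sub>R b)"
        by (auto simp: in_segment)
      let ?S = "(1 - u) * s a + u * s b"
      let ?v = "u * s b / ?S"
      have S: "?S > 0" using u sab by (simp add: add_pos_pos)
      have "0 < ?v" using S u sab by simp
      moreover have "?v < 1" using S u sab by (simp add: field_simps)
      moreover have "y = (1 - ?v) *\<^sub>R ?T a + ?v *\<^sub>R ?T b"
        unfolding u(3) using S by (intro T u) simp
      ultimately show "y \<in> open_segment (?T a) (?T b)"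
        using neq unfolding in_segment by blast
    next
      fix y assume "y \<in> open_segment (?T a) (?T b)"
      then obtain v where v: "0 < v" "v < 1" "y = (1 - v) *\<^sub>R ?T a + v *\<^sub>R ?T b"
        by (auto simp: in_segment)
      \<comment> \<open>\<open>D\<close> normalizes the weights of the inverse reparametrization,
        \<open>v * s a\<close> for \<open>b\<close> and \<open>(1 - v) * s b\<close> for
        \<open>a\<close>.\<close>
      define D where "D = (1 - v) * s b + v * s a"
      have D: "D > 0" using v sab by (simp add: D_def add_pos_pos)
      define u where "u = v * s a / D"
      have uD: "u * D = v * s a" using D by (simp add: u_def)
      then have uD': "(1 - u) * D = (1 - v) * s b" by (simp add: left_diff_distrib D_def)
      have "u * D > 0" "(1 - u) * D > 0" unfolding uD uD' using v sab by simp_all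
      then have u: "0 < u" "u < 1" using D by (simp_all add: zero_less_mult_iff)
      have "v * ((1 - u) * s a + u * s b) * D = v * (s a * ((1 - u) * D) + s b * (u * D))"
        by (simp add: algebra_simps)
      also have "\<dots> = u * D * s b"
        unfolding uD uD' by (simp add: algebra_simps)
      finally have "v * ((1 - u) * s a + u * s b) = u * s b" using D by simp
      from T[OF u this] have "y = ?T ((1 - u) *\<^sub>R a + u *\<^sub>R b)" using v(3) by simp
      moreover have "(1 - u) *\<^sub>R a + u *\<^sub>R b \<in> open_segment a b"
        using u False unfolding in_segment by blast
      ultimately show "y \<in> ?T ` open_segment a b" by blast
    qed
  qed simp
  with inj show ?thesis by (simp add: preserves_segments_def)
qed

lemma preserves_segments_affine:
  fixes M :: "'a::euclidean_space \<Rightarrow> 'b::euclidean_space"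
  assumes "convex K"
    and "\<And>a b t. M ((1 - t) *\<^sub>R a + t *\<^sub>R b) = (1 - t) *\<^sub>R M a + t *\<^sub>R M b"
    and "inj_on M K"
  shows "preserves_segments K M"
  using preserves_segments_projective[of K M "\<lambda>_. 1"] assms by simp

lemma preserves_segments_convex_iff:
  assumes "preserves_segments K T" "convex K" "S \<subseteq> K"
  shows "convex (T ` S) \<longleftrightarrow> convex S"
proof -
  have "T ` open_segment a b \<subseteq> T ` S \<longleftrightarrow> open_segment a b \<subseteq> S" if "a \<in> S" "b \<in> S" for a b
  proof -
    have "open_segment a b \<subseteq> K"
      using assms that by (auto simp: convex_contains_open_segment)
    then show ?thesis
      using assms by (intro inj_on_image_subset_iff) (auto simp: preserves_segments_def)
  qed
  moreover have "T ` open_segment a b = open_segment (T a) (T b)" if "a \<in> S" "b \<in> S" for a b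
    using assms(1,3) that unfolding preserves_segments_def by blast
  ultimately show ?thesis
    by (simp add: convex_contains_open_segment)
qed

lemma preserves_segments_face_of_iff:
  assumes T: "preserves_segments K T" and K: "convex K" and F: "F \<subseteq> K"
  shows "T ` F face_of T ` K \<longleftrightarrow> F face_of K"
proof -
  have inj: "T x \<in> T ` F \<longleftrightarrow> x \<in> F" if "x \<in> K" for x
    using T F that by (auto simp: preserves_segments_def dest: inj_onD)
  have seg: "T x \<in> open_segment (T a) (T b) \<longleftrightarrow> x \<in> open_segment a b"
    if "x \<in> K" "a \<in> K" "b \<in> K" for x a b
  proof -
    have "open_segment a b \<subseteq> K"
      using K that by (auto simp: convex_contains_open_segment)
    then have "T x \<in> T ` open_segment a b \<longleftrightarrow> x \<in> open_segment a b"
      using T that by (intro inj_on_image_mem_iff) (auto simp: preserves_segments_def)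
    then show ?thesis using T that by (simp add: preserves_segments_def)
  qed
  have FK: "x \<in> K" if "x \<in> F" for x using F that by blast
  have "T ` F \<subseteq> T ` K" using F by (rule image_mono)
  then show ?thesis
    using F preserves_segments_convex_iff[OF T K F]
    unfolding face_of_def by (simp add: inj seg FK)
qed

lemma preserves_segments_faces:
  assumes T: "preserves_segments K T" and K: "convex K"
  shows "{F. F face_of T ` K} = (`) T ` {F. F face_of K}"
proof (intro equalityI subsetI)
  fix F assume "F \<in> {F. F face_of T ` K}"
  then have F: "F face_of T ` K" by simp
  then have "F = T ` (K \<inter> T -` F)" using face_of_imp_subset by fastforce
  with F have "K \<inter> T -` F face_of K"
    using preserves_segments_face_of_iff[OF T K, of "K \<inter> T -` F"] by simp
  with \<open>F = T ` (K \<inter> T -` F)\<close> show "F \<in> (`) T ` {F. F face_of K}" by blast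
next
  fix F assume "F \<in> (`) T ` {F. F face_of K}"
  then show "F \<in> {F. F face_of T ` K}"
    using preserves_segments_face_of_iff[OF T K] face_of_imp_subset by blast
qed

lemma preserves_segments_face_lattice_iso:
  assumes T: "preserves_segments K T" and K: "convex K" and iso: "face_lattice_iso A le K \<psi>"
  shows "face_lattice_iso A le (T ` K) (\<lambda>x. T ` \<psi> x)"
proof -
  have inj: "inj_on T K" using T by (simp add: preserves_segments_def)
  have bij: "bij_betw \<psi> A {F. F face_of K}"
    and le: "\<And>x y. x \<in> A \<Longrightarrow> y \<in> A \<Longrightarrow> le x y \<longleftrightarrow> \<psi> x \<subseteq> \<psi> y"
    using iso by (auto simp: face_lattice_iso_def poset_iso_def)
  have sub: "\<psi> x \<subseteq> K" if "x \<in> A" for x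
    using bij_betw_apply[OF bij that] by (simp add: face_of_imp_subset)
  have "inj_on ((`) T) {F. F face_of K}"
    using inj_on_image_eq_iff[OF inj] by (intro inj_onI) (simp add: face_of_imp_subset)
  then have "bij_betw ((`) T) {F. F face_of K} {F. F face_of T ` K}"
    unfolding preserves_segments_faces[OF T K] by (rule inj_on_imp_bij_betw)
  then have "bij_betw ((`) T \<circ> \<psi>) A {F. F face_of T ` K}"
    by (rule bij_betw_trans[OF bij])
  moreover have "le x y \<longleftrightarrow> T ` \<psi> x \<subseteq> T ` \<psi> y" if "x \<in> A" "y \<in> A" for x y
    using le that sub inj_on_image_subset_iff[OF inj] by simp
  ultimately show ?thesis
    by (simp add: face_lattice_iso_def poset_iso_def o_def)
qed

text \<open>As \<open>T\<close> need not be affine, the hull is pulled back instead of pushed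
  forward: the points mapped into the hull of the images of the generators form a convex set that
  contains the generators, hence all of \<open>K\<close>.\<close>

lemma preserves_segments_polytope:
  assumes T: "preserves_segments K T" and K: "polytope K"
  shows "polytope (T ` K)"
proof -
  have conv: "convex K" using K by (rule polytope_imp_convex)
  obtain X where X: "finite X" "K = convex hull X" using K by (auto simp: polytope_def)
  have XK: "X \<subseteq> K" unfolding X(2) by (rule hull_subset)
  have convT: "convex (T ` K)" using preserves_segments_convex_iff[OF T conv] conv by simp
  let ?S = "{x \<in> K. T x \<in> convex hull (T ` X)}"
  have "T ` ?S = T ` K \<inter> convex hull (T ` X)" by blast
  then have "convex (T ` ?S)" using convT by (simp add: convex_Int)
  then have "convex ?S" using preserves_segments_convex_iff[OF T conv, of ?S] by simp
  moreover have "X \<subseteq> ?S" using XK hull_subset[of "T ` X" convex] by auto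
  ultimately have "K \<subseteq> ?S" by (subst X(2)) (rule hull_minimal)
  moreover have "convex hull (T ` X) \<subseteq> T ` K"
    using XK convT by (intro hull_minimal) auto
  ultimately have "T ` K = convex hull (T ` X)" by blast
  then show ?thesis using X(1) by (simp add: polytope_convex_hull)
qed

lemma preserves_segments_subset:
  "preserves_segments K T \<Longrightarrow> S \<subseteq> K \<Longrightarrow> preserves_segments S T"
  by (auto simp: preserves_segments_def inj_on_subset subset_iff)

text \<open>With no linear map at hand, the dimensions are compared through the face lattices, with
  the faces of \<open>K\<close> as their own indices.\<close>

lemma preserves_segments_aff_dim:
  assumes T: "preserves_segments K T" and K: "polytope K"
  shows "aff_dim (T ` K) = aff_dim K"
proof -
  have "face_lattice_iso {F. F face_of K} (\<subseteq>) K (\<lambda>F. F)"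
    by (simp add: face_lattice_iso_def poset_iso_def bij_betw_def)
  with preserves_segments_face_lattice_iso[OF T polytope_imp_convex[OF K] this]
  show ?thesis
    using aff_dim_eq_face_lattice preserves_segments_polytope[OF T K] K by blast
qed

section \<open>Projective normalization of disjoint facets\<close>

lemma centered_isometric_image:
  fixes h :: "'a::euclidean_space \<Rightarrow> 'b::euclidean_space"
  assumes Z: "subspace Z" and X: "centered Z X"
    and h: "linear h" "\<And>z. z \<in> Z \<Longrightarrow> norm (h z) = norm z"
  shows "centered (h ` Z) (h ` X)"
proof -
  obtain e where e: "e > 0" "ball 0 e \<inter> Z \<subseteq> X"
    using centered_ballE[OF Z X] .
  have "ball 0 e \<inter> h ` Z \<subseteq> h ` X"
  proof
    fix y assume "y \<in> ball 0 e \<inter> h ` Z"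
    then obtain z where z: "z \<in> Z" "y = h z" "norm y < e" by auto
    then have "z \<in> ball 0 e \<inter> Z" using h(2) by simp
    with e(2) z(2) show "y \<in> h ` X" by blast
  qed
  then show ?thesis
    using e(1) centered_imp_subset[OF X] linear_subspace_image[OF h(1) Z]
    by (auto simp: centered_iff_ball intro!: exI[of _ e])
qed

lemma centered_translation:
  fixes S :: "'a::euclidean_space set"
  assumes Z: "subspace Z" and q: "q \<in> rel_interior S"
    and sub: "(\<lambda>x. x - q) ` S \<subseteq> Z" and dim: "int (dim Z) \<le> aff_dim S"
  shows "centered Z ((\<lambda>x. x - q) ` S)"
proof -
  let ?X = "(\<lambda>x. x - q) ` S"
  have X: "?X = (+) (- q) ` S" by (simp add: image_def algebra_simps)
  have "S \<noteq> {}" using q rel_interior_subset by blast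
  have "(+) (- q) q \<in> (+) (- q) ` rel_interior S" using q by (rule imageI)
  then have ri: "0 \<in> rel_interior ?X"
    unfolding X rel_interior_translation by simp
  have subZ: "affine hull ?X \<subseteq> Z"
    using sub subspace_imp_affine[OF Z] by (rule hull_minimal)
  have "aff_dim ?X = aff_dim S" unfolding X by (rule aff_dim_translation_eq)
  moreover have "aff_dim (affine hull ?X) \<le> aff_dim Z" using subZ by (rule aff_dim_subset)
  ultimately have "aff_dim (affine hull ?X) = aff_dim Z"
    using dim aff_dim_subspace[OF Z] by simp
  with subZ have "affine hull ?X = Z"
    using \<open>S \<noteq> {}\<close> subspace_imp_affine[OF Z] by (intro affine_dim_equal) auto
  with ri show ?thesis by (simp add: centered_iff_rel_interior[OF Z])
qed

text \<open>A shear moves the two slices over each other so that chosen relative interior points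
  \<open>q0\<close> and \<open>q1\<close> both land over the origin. This is what makes both ends
  centered in one and the same subspace.\<close>

lemma parallel_facets_normalization:
  fixes K :: "'c::euclidean_space set" and \<alpha> :: "'c \<Rightarrow> real"
  assumes K: "convex K" and \<alpha>: "linear \<alpha>"
    and S0: "S0 = {x \<in> K. \<alpha> x = 0}" "S0 \<noteq> {}" "aff_dim S0 = aff_dim K - 1"
    and S1: "S1 = {x \<in> K. \<alpha> x = 1}" "S1 \<noteq> {}" "aff_dim S1 = aff_dim K - 1"
    and dim: "aff_dim K \<le> int DIM('a) + 1"
  obtains T :: "'c \<Rightarrow> 'a::euclidean_space \<times> real" and V P R
  where "preserves_segments K T" "subspace V" "centered V P" "centered V R"
    "T ` S0 = P \<times> {0}" "T ` S1 = R \<times> {1}"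
proof -
  interpret \<alpha>: linear \<alpha> by (rule \<alpha>)
  have slice: "convex {x \<in> K. \<alpha> x = c}" for c
    using K by (auto simp: convex_def \<alpha>.add \<alpha>.scaleR algebra_simps) (metis distrib_right mult_1)
  obtain q0 where q0: "q0 \<in> rel_interior S0"
    using rel_interior_eq_empty slice[of 0] S0 by blast
  obtain q1 where q1: "q1 \<in> rel_interior S1"
    using rel_interior_eq_empty slice[of 1] S1 by blast
  have "q0 \<in> S0" "q1 \<in> S1" using q0 q1 rel_interior_subset by blast+
  then have q: "q0 \<in> K" "\<alpha> q0 = 0" "q1 \<in> K" "\<alpha> q1 = 1" using S0 S1 by auto
  define D where "D = span ((\<lambda>x. x - q0) ` K)"
  \<comment> \<open>The common directions of the slices. As \<open>q1 - q0\<close> lies in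
    \<open>D\<close> but not in \<open>Z\<close>, the dimension of \<open>Z\<close> is at most that
    of the slices, so the translated slices span \<open>Z\<close>; by \<open>dim\<close>, the space
    \<open>Z\<close> also fits into \<open>'a\<close>.\<close>
  define Z where "Z = {z \<in> D. \<alpha> z = 0}"
  have D: "subspace D" unfolding D_def by simp
  have KD: "x - q0 \<in> D" if "x \<in> K" for x
    unfolding D_def using that by (intro span_base imageI)
  have Z: "subspace Z"
    using D unfolding Z_def subspace_def by (auto simp: \<alpha>.add \<alpha>.scaleR \<alpha>.zero)
  have "q1 - q0 \<in> D - Z" using KD q by (simp add: Z_def \<alpha>.diff)
  moreover have "Z \<subseteq> D" by (auto simp: Z_def)
  ultimately have "Z \<subset> D" by blast
  then have "span Z \<subset> span D"
    by (simp only: span_eq_iff[THEN iffD2, OF Z] span_eq_iff[THEN iffD2, OF D])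
  then have "dim Z < dim D" by (rule dim_psubset)
  moreover have "aff_dim K = int (dim D)"
    unfolding D_def using aff_dim_eq_dim_subtract[of q0 K] q(1) by (simp add: hull_inc)
  ultimately have dimZ: "int (dim Z) \<le> aff_dim K - 1" by simp
  have "dim Z \<le> dim (UNIV :: 'a set)" using dimZ dim by simp
  then obtain h :: "'c \<Rightarrow> 'a" where h: "linear h" "\<And>x. x \<in> Z \<Longrightarrow> norm (h x) = norm x"
    using isometry_subset_subspace[OF Z subspace_UNIV] by metis
  interpret h: linear h by (rule h(1))
  \<comment> \<open>Subtracting \<open>\<alpha> x *\<^sub>R (q1 - q0)\<close> slides
    \<open>x\<close> into the slice through \<open>q0\<close>; \<open>h\<close> then embeds the
    directions isometrically, and \<open>\<alpha>\<close> is kept as the height.\<close>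
  define T where "T x = (h (x - q0 - \<alpha> x *\<^sub>R (q1 - q0)), \<alpha> x)" for x
  have inZ: "x - q0 - \<alpha> x *\<^sub>R (q1 - q0) \<in> Z" if "x \<in> K" for x
    using KD[OF that] KD[OF q(3)] D q
    by (simp add: Z_def subspace_diff subspace_scale \<alpha>.diff \<alpha>.scaleR)
  have "inj_on T K"
  proof (rule inj_onI)
    fix x y assume xy: "x \<in> K" "y \<in> K" "T x = T y"
    let ?z = "\<lambda>x. x - q0 - \<alpha> x *\<^sub>R (q1 - q0)"
    have "h (?z x - ?z y) = 0" using xy(3) unfolding T_def h.diff by auto
    moreover have "?z x - ?z y \<in> Z" using subspace_diff[OF Z inZ inZ] xy by simp
    ultimately have "?z x - ?z y = 0" using h(2) by (metis norm_eq_zero norm_zero)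
    moreover have "\<alpha> x = \<alpha> y" using xy(3) by (simp add: T_def)
    ultimately show "x = y" by simp
  qed
  moreover have "T ((1 - t) *\<^sub>R a + t *\<^sub>R b) = (1 - t) *\<^sub>R T a + t *\<^sub>R T b" for a b t
  proof -
    let ?x = "(1 - t) *\<^sub>R a + t *\<^sub>R b" and ?z = "\<lambda>x. x - q0 - \<alpha> x *\<^sub>R (q1 - q0)"
    have \<alpha>x: "\<alpha> ?x = (1 - t) * \<alpha> a + t * \<alpha> b"
      by (simp only: \<alpha>.add \<alpha>.scaleR real_scaleR_def)
    have "?z ?x = (1 - t) *\<^sub>R ?z a + t *\<^sub>R ?z b"
      unfolding \<alpha>x by (simp add: algebra_simps)
    then have "h (?z ?x) = (1 - t) *\<^sub>R h (?z a) + t *\<^sub>R h (?z b)"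
      by (simp only: h.add h.scaleR)
    then show ?thesis unfolding T_def by (simp only: \<alpha>x scaleR_Pair add_Pair real_scaleR_def)
  qed
  ultimately have "preserves_segments K T"
    by (intro preserves_segments_affine[OF K])
  moreover have "centered (h ` Z) (h ` (\<lambda>x. x - q0) ` S0)"
  proof (rule centered_isometric_image[OF Z _ h])
    show "centered Z ((\<lambda>x. x - q0) ` S0)"
    proof (rule centered_translation[OF Z q0])
      show "(\<lambda>x. x - q0) ` S0 \<subseteq> Z"
      proof (rule image_subsetI)
        fix x assume "x \<in> S0"
        then have "x \<in> K" "\<alpha> x = 0" using S0(1) by auto
        then show "x - q0 \<in> Z" using inZ[of x] by simp
      qed
      show "int (dim Z) \<le> aff_dim S0" using dimZ S0(3) by simp
    qed
  qed
  moreover have "centered (h ` Z) (h ` (\<lambda>x. x - q1) ` S1)"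
  proof (rule centered_isometric_image[OF Z _ h])
    show "centered Z ((\<lambda>x. x - q1) ` S1)"
    proof (rule centered_translation[OF Z q1])
      show "(\<lambda>x. x - q1) ` S1 \<subseteq> Z"
      proof (rule image_subsetI)
        fix x assume "x \<in> S1"
        then have "x \<in> K" "\<alpha> x = 1" using S1(1) by auto
        then show "x - q1 \<in> Z" using inZ[of x] by simp
      qed
      show "int (dim Z) \<le> aff_dim S1" using dimZ S1(3) by simp
    qed
  qed
  moreover have "T ` S0 = (h ` (\<lambda>x. x - q0) ` S0) \<times> {0}"
    using S0 by (force simp: T_def image_iff)
  moreover have "T ` S1 = (h ` (\<lambda>x. x - q1) ` S1) \<times> {1}"
    using S1 by (force simp: T_def image_iff)
  moreover have "subspace (h ` Z)" using h(1) Z by (rule linear_subspace_image)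
  ultimately show thesis using that by blast
qed

lemma facet_affine_functional:
  fixes K :: "'a::euclidean_space set"
  assumes "polytope K" "F face_of K" "F \<noteq> K"  "F \<noteq> {}"
  obtains u c where "\<And>x. x \<in> K \<Longrightarrow> u \<bullet> x \<le> c" "F = {x \<in> K. u \<bullet> x = c}"
proof -
  obtain u where u: "argmax_face u K = F"
    using face_eq_argmax_face[OF assms(1,2,4) subspace_UNIV] by auto
  obtain x where x: "x \<in> argmax_face u K" using u assms(4) by blast
  have "F = {y \<in> K. u \<bullet> y = u \<bullet> x}" using argmax_face_eq[OF x] u by blast
  moreover have "u \<bullet> y \<le> u \<bullet> x" if "y \<in> K" for y using x that by (simp add: argmax_face_def)
  ultimately show thesis using that by blast
qed

text \<open>
  The function \<open>s\<close> below is positive on the polytope and vanishes where the two facet hyperplanes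
  meet, so dividing by it sends their intersection to infinity.
\<close>

lemma disjoint_facets_normalization:
  fixes K :: "'b::euclidean_space set"
  assumes K: "polytope K"
    and F0: "F0 facet_of K" and F1: "F1 facet_of K" and disj: "F0 \<inter> F1 = {}"
    and dim: "aff_dim K \<le> int DIM('a) + 1"
  obtains T :: "'b \<Rightarrow> 'a::euclidean_space \<times> real" and V P R
  where "preserves_segments K T" "subspace V" "centered V P" "centered V R"
    "T ` F0 = P \<times> {0}" "T ` F1 = R \<times> {1}"
proof -
  have F: "F0 face_of K" "F0 \<noteq> {}" "aff_dim F0 = aff_dim K - 1" "F0 \<noteq> K"
    "F1 face_of K" "F1 \<noteq> {}" "aff_dim F1 = aff_dim K - 1" "F1 \<noteq> K"
    using F0 F1 by (auto simp: facet_of_def)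
  obtain u0 c0 where u0: "\<And>x. x \<in> K \<Longrightarrow> u0 \<bullet> x \<le> c0" "F0 = {x \<in> K. u0 \<bullet> x = c0}"
    using facet_affine_functional[OF K F(1,4,2)] by metis
  obtain u1 c1 where u1: "\<And>x. x \<in> K \<Longrightarrow> u1 \<bullet> x \<le> c1" "F1 = {x \<in> K. u1 \<bullet> x = c1}"
    using facet_affine_functional[OF K F(5,8,6)] by metis
  have conv: "convex K" using K by (rule polytope_imp_convex)
  define s where "s x = (c0 - u0 \<bullet> x) + (c1 - u1 \<bullet> x)" for x
  have pos: "s x > 0" if "x \<in> K" for x
    using u0(1)[OF that] u1(1)[OF that] disj that u0(2) u1(2)
    by (cases "u0 \<bullet> x = c0"; cases "u1 \<bullet> x = c1") (auto simp: s_def)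
  \<comment> \<open>Homogeneous coordinates divided by \<open>s\<close>. The last coordinate
    determines \<open>s x\<close> and hence \<open>x\<close>, which gives injectivity.\<close>
  define T1 where "T1 x = (1 / s x) *\<^sub>R (x, 1 :: real)" for x
  \<comment> \<open>The homogenized slack of the first facet. On the image of \<open>K\<close> it
    equals the share of this slack in the sum \<open>s\<close> of both slacks: 0 exactly on
    \<open>F0\<close>, and 1 exactly where the second slack vanishes, on \<open>F1\<close>.\<close>
  define \<alpha> where "\<alpha> = (\<lambda>z :: 'b \<times> real. c0 * snd z - u0 \<bullet> fst z)"
  have \<alpha>: "linear \<alpha>"
    by (auto intro!: linearI simp: \<alpha>_def inner_add_right algebra_simps)
  have \<alpha>T: "\<alpha> (T1 x) = (c0 - u0 \<bullet> x) / s x" for x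
    by (simp add: \<alpha>_def T1_def diff_divide_distrib)
  have "inj_on T1 K"
  proof (rule inj_onI)
    fix x y assume xy: "x \<in> K" "y \<in> K" "T1 x = T1 y"
    then have "s x = s y" by (simp add: T1_def)
    with xy pos[OF xy(1)] show "x = y" by (simp add: T1_def)
  qed
  then have T1: "preserves_segments K T1"
    unfolding T1_def[abs_def]
    using pos by (intro preserves_segments_projective[OF conv])
      (auto simp: s_def inner_add_right algebra_simps)
  have F0_eq: "T1 ` F0 = {z \<in> T1 ` K. \<alpha> z = 0}"
    using pos by (fastforce simp: \<alpha>T u0(2))
  have F1_eq: "T1 ` F1 = {z \<in> T1 ` K. \<alpha> z = 1}"
  proof -
    have "\<alpha> (T1 x) = 1 \<longleftrightarrow> u1 \<bullet> x = c1" if "x \<in> K" for x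
      using pos[OF that] by (auto simp: \<alpha>T s_def)
    then show ?thesis by (auto simp: u1(2))
  qed
  have dims: "aff_dim (T1 ` F) = aff_dim F" if "F face_of K" for F
    using that K by (intro preserves_segments_aff_dim preserves_segments_subset[OF T1])
      (auto simp: face_of_imp_subset face_of_polytope_polytope)
  have dimK: "aff_dim (T1 ` K) = aff_dim K"
    using T1 K by (rule preserves_segments_aff_dim)
  have convT: "convex (T1 ` K)"
    using preserves_segments_convex_iff[OF T1 conv] conv by simp
  obtain T2 :: "'b \<times> real \<Rightarrow> 'a \<times> real" and V P R
    where T2: "preserves_segments (T1 ` K) T2" "subspace V" "centered V P" "centered V R"
    "T2 ` T1 ` F0 = P \<times> {0}" "T2 ` T1 ` F1 = R \<times> {1}"
    using parallel_facets_normalization[OF convT \<alpha> F0_eq _ _ F1_eq, where 'a = 'a] F dims dimK dim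
    by (metis image_is_empty)
  have "preserves_segments K (T2 \<circ> T1)"
  proof -
    have "inj_on (T2 \<circ> T1) K"
      using T1 T2(1) by (intro comp_inj_on) (auto simp: preserves_segments_def)
    moreover have "(T2 \<circ> T1) ` open_segment a b = open_segment ((T2 \<circ> T1) a) ((T2 \<circ> T1) b)"
      if "a \<in> K" "b \<in> K" for a b
    proof -
      have "T1 ` open_segment a b = open_segment (T1 a) (T1 b)"
        using T1 that unfolding preserves_segments_def by blast
      moreover have "T2 ` open_segment (T1 a) (T1 b) = open_segment (T2 (T1 a)) (T2 (T1 b))"
        using T2(1) that unfolding preserves_segments_def by blast
      ultimately show ?thesis by (simp only: image_comp[symmetric] o_apply)
    qed
    ultimately show ?thesis by (simp add: preserves_segments_def)
  qed
  then show thesis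
    using T2 by (intro that[of "T2 \<circ> T1" V P R]) (simp_all add: image_comp)
qed

section \<open>From balanced pairs to antiprisms\<close>

lemma join_hull_subset_iff:
  assumes "convex G" "convex H" "convex G'" "convex H'"
  shows "join_hull G H \<subseteq> join_hull G' H' \<longleftrightarrow> G \<subseteq> G' \<and> H \<subseteq> H'"
proof
  assume sub: "join_hull G H \<subseteq> join_hull G' H'"
  have "x \<in> G'" if "x \<in> G" for x
    using that subsetD[OF sub, of "(x, 0)"] assms by (simp add: join_hull_0_iff)
  moreover have "x \<in> H'" if "x \<in> H" for x
    using that subsetD[OF sub, of "(x, 1)"] assms by (simp add: join_hull_1_iff)
  ultimately show "G \<subseteq> G' \<and> H \<subseteq> H'" by blast
qed (simp add: join_hull_mono)

lemma join_hull_empty_right: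
  assumes "convex G"
  shows "join_hull G {} = G \<times> {0}"
  using assms by (simp add: join_hull_def convex_hull_eq convex_Times)

lemma join_hull_empty_left:
  assumes "convex H"
  shows "join_hull {} H = H \<times> {1}"
  using assms by (simp add: join_hull_def convex_hull_eq convex_Times)

lemma snd_join_hull:
  assumes "z \<in> join_hull P R"
  shows "0 \<le> snd z" "snd z \<le> 1"
proof -
  have "convex (UNIV \<times> {0..1} :: ('a \<times> real) set)" by (intro convex_Times) auto
  then have "join_hull P R \<subseteq> UNIV \<times> {0..1}"
    unfolding join_hull_def by (intro hull_minimal) auto
  with assms show "0 \<le> snd z" "snd z \<le> 1" by auto
qed

lemma bottom_face_of_join_hull:
  assumes "convex P"
  shows "P \<times> {0} face_of join_hull P R"
proof -
  have "join_hull P R \<inter> {z. (0, 1) \<bullet> z = 0} face_of join_hull P R"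
    using snd_join_hull by (intro face_of_Int_supporting_hyperplane_ge)
      (auto simp: inner_Pair_0 inner_prod_def join_hull_def)
  also have "join_hull P R \<inter> {z. (0, 1) \<bullet> z = 0} = P \<times> {0}"
    using assms by (auto simp: inner_prod_def join_hull_0_iff)
  finally show ?thesis .
qed

lemma top_face_of_join_hull:
  assumes "convex R"
  shows "R \<times> {1} face_of join_hull P R"
proof -
  have "join_hull P R \<inter> {z. (0, 1) \<bullet> z = 1} face_of join_hull P R"
    using snd_join_hull by (intro face_of_Int_supporting_hyperplane_le)
      (auto simp: inner_prod_def join_hull_def)
  also have "join_hull P R \<inter> {z. (0, 1) \<bullet> z = 1} = R \<times> {1}"
    using assms by (auto simp: inner_prod_def join_hull_1_iff)
  finally show ?thesis .
qed

lemma face_of_Times_singleton: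
  fixes F P :: "'a::euclidean_space set" and c :: real
  shows "F \<times> {c} face_of P \<times> {c} \<longleftrightarrow> F face_of P"
proof -
  have "{c} face_of {c}" by (simp add: face_of_refl)
  then show ?thesis by (auto simp: face_of_Times_eq)
qed

lemma join_hull_empty_face_of:
  assumes "convex P" "convex R"
  shows "G face_of P \<Longrightarrow> join_hull G {} face_of join_hull P R"
    and "H face_of R \<Longrightarrow> join_hull {} H face_of join_hull P R"
proof -
  show "join_hull G {} face_of join_hull P R" if "G face_of P"
    unfolding join_hull_empty_right[OF face_of_imp_convex[OF that]]
    by (rule face_of_trans[OF face_of_Times_singleton[THEN iffD2, OF that]
          bottom_face_of_join_hull[OF assms(1)]])
  show "join_hull {} H face_of join_hull P R" if "H face_of R"
    unfolding join_hull_empty_left[OF face_of_imp_convex[OF that]]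
    by (rule face_of_trans[OF face_of_Times_singleton[THEN iffD2, OF that]
          top_face_of_join_hull[OF assms(2)]])
qed

text \<open>The end slices of a face are its intersections with the bottom and the top face of the
  hull, hence faces of these; possibly they are empty.\<close>

lemma face_of_join_hull_cases:
  assumes PR: "compact P" "convex P" "compact R" "convex R" and F: "F face_of join_hull P R"
  obtains G H where "G face_of P" "H face_of R" "F = join_hull G H"
proof -
  let ?G = "{x. (x, 0) \<in> F}" and ?H = "{x. (x, 1) \<in> F}"
  have sub: "F \<subseteq> join_hull P R" using F by (rule face_of_imp_subset)
  have "F \<inter> P \<times> {0} = ?G \<times> {0}" "F \<inter> R \<times> {1} = ?H \<times> {1}"
    using sub PR join_hull_0_iff[of P _ R] join_hull_1_iff[of R _ P] by auto
  moreover have "F \<inter> P \<times> {0} face_of P \<times> {0}" "F \<inter> R \<times> {1} face_of R \<times> {1}"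
    using face_of_Int[OF F bottom_face_of_join_hull[OF PR(2)]]
      face_of_Int[OF F top_face_of_join_hull[OF PR(4)]]
    by (simp_all add: face_of_face[OF bottom_face_of_join_hull[OF PR(2), of R]]
        face_of_face[OF top_face_of_join_hull[OF PR(4), of P]])
  ultimately have "?G face_of P" "?H face_of R"
    by (simp_all add: face_of_Times_singleton)
  with face_of_join_hull_eq[OF PR(1,3) F] that show thesis by blast
qed

text \<open>A functional that is maximal on all of \<open>R\<close> is maximal at the origin, around
  which \<open>R\<close> is a neighborhood in \<open>V\<close>. It therefore vanishes on
  \<open>V\<close> and exposes the whole of \<open>P\<close>.\<close>

lemma face_of_join_hull_full_top:
  assumes V: "subspace V" and P: "polytope P" "P \<subseteq> V" and R: "polytope R" "centered V R"
    and G: "convex G" "G \<noteq> {}" and F: "join_hull G R face_of join_hull P R"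
  shows "G = P"
proof -
  have zR: "0 \<in> R" using zero_in_centered[OF V R(2)] .
  obtain u where u: "argmax_face u P = G" "argmax_face u R = R"
    using face_of_join_hullD[OF P(1) R(1) G(1) polytope_imp_convex[OF R(1)] G(2) _ F] zR by blast
  obtain v where v: "v \<in> V" "\<And>x. x \<in> V \<Longrightarrow> v \<bullet> x = u \<bullet> x"
    using subspace_inner_representative[OF V] by metis
  have vP: "argmax_face v P = G"
    unfolding u(1)[symmetric] by (intro argmax_face_cong v(2) subsetD[OF P(2)])
  have "argmax_face v R = argmax_face u R"
    by (intro argmax_face_cong v(2) subsetD[OF centered_imp_subset[OF R(2)]])
  with zR u(2) have "0 \<in> argmax_face v R" by simp
  then have "\<not> v \<bullet> p > 0" if "p \<in> R" for p
    using that by (auto simp: argmax_face_def)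
  then have "v = 0" using centered_positive_direction[OF V R(2) v(1)] by metis
  with vP show ?thesis by simp
qed

section \<open>The face lattice of the hull built from a balanced pair\<close>

lemma realizationD:
  assumes "bounded_poset A le bt tp" "realization A le P \<phi>"
  shows "\<And>x. x \<in> A \<Longrightarrow> \<phi> x face_of P"
    and "\<And>x y. x \<in> A \<Longrightarrow> y \<in> A \<Longrightarrow> le x y \<longleftrightarrow> \<phi> x \<subseteq> \<phi> y"
    and "\<And>F. F face_of P \<Longrightarrow> \<exists>x\<in>A. \<phi> x = F"
    and "\<And>x y. x \<in> A \<Longrightarrow> y \<in> A \<Longrightarrow> \<phi> x = \<phi> y \<longleftrightarrow> x = y"
    and "\<phi> bt = {}" "\<phi> tp = P" "bt \<noteq> tp"
proof -
  have bij: "bij_betw \<phi> A {F. F face_of P}"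
    using assms(2) by (simp add: realization_def face_lattice_iso_def poset_iso_def)
  have P: "P face_of P" "P \<noteq> {}"
    using assms(2) by (auto simp: realization_def face_of_refl polytope_imp_convex)
  show face: "\<phi> x face_of P" if "x \<in> A" for x
    using bij_betw_apply[OF bij that] by simp
  show le: "le x y \<longleftrightarrow> \<phi> x \<subseteq> \<phi> y" if "x \<in> A" "y \<in> A" for x y
    using assms(2) that by (simp add: realization_def face_lattice_iso_def poset_iso_def)
  show surj: "\<exists>x\<in>A. \<phi> x = F" if "F face_of P" for F
  proof -
    have "F \<in> \<phi> ` A" using bij that by (simp add: bij_betw_def)
    then show ?thesis by blast
  qed
  show "\<phi> x = \<phi> y \<longleftrightarrow> x = y" if "x \<in> A" "y \<in> A" for x y
    using bij that by (auto simp: bij_betw_def dest: inj_onD)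
  have bd: "bt \<in> A" "tp \<in> A" "\<And>x. x \<in> A \<Longrightarrow> le bt x" "\<And>x. x \<in> A \<Longrightarrow> le x tp"
    using assms(1) by (simp_all add: bounded_poset_def)
  obtain x where "x \<in> A" "\<phi> x = {}" using surj[OF empty_face_of] by blast
  with le bd show bot: "\<phi> bt = {}" by blast
  obtain y where y: "y \<in> A" "\<phi> y = P" using surj[OF P(1)] by blast
  then have "P \<subseteq> \<phi> tp" using le bd by blast
  then show top: "\<phi> tp = P" using face_of_imp_subset[OF face[OF bd(2)]] by blast
  show "bt \<noteq> tp" using bot top P(2) by auto
qed

lemma antiprism_le_antisymp:
  assumes "bounded_poset A le bt tp"
  shows "antisymp_on (antiprism_carrier A le) (antiprism_le le)"
proof (rule antisymp_onI)
  fix x y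
  assume xy: "x \<in> antiprism_carrier A le" "y \<in> antiprism_carrier A le"
    "antiprism_le le x y" "antiprism_le le y x"
  have anti: "a = b" if "a \<in> A" "b \<in> A" "le a b" "le b a" for a b
    using assms that by (auto simp: bounded_poset_def dest: antisymp_onD)
  show "x = y"
    using xy anti by (cases x; cases y) (auto simp: antiprism_carrier_def)
qed

text \<open>\<open>Some (g, f)\<close> indexes the hull of the face \<open>g\<close> at height 0 and
  the dual of the face \<open>f\<close> at height 1. Balancedness decides the pairs with two proper
  ends; those with an empty end are always faces and always intervals.\<close>

lemma balanced_pair_imp_antiprism:
  assumes bp: "bounded_poset A le bt tp"
    and bal: "balanced_pair A le bt V P\<^sub>0 \<phi>\<^sub>0 P\<^sub>1 \<phi>\<^sub>1"
  shows "antiprism A le (join_hull P\<^sub>0 (polar V P\<^sub>1))"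
proof -
  let ?R = "polar V P\<^sub>1" and ?D = "\<lambda>f. dual_face V P\<^sub>1 (\<phi>\<^sub>1 f)"
  let ?K = "join_hull P\<^sub>0 ?R"
  have V: "subspace V" and r0: "realization A le P\<^sub>0 \<phi>\<^sub>0" and r1: "realization A le P\<^sub>1 \<phi>\<^sub>1"
    and c0: "centered V P\<^sub>0" and c1: "centered V P\<^sub>1"
    and bal': "\<And>g f. g \<in> A - {bt} \<Longrightarrow> f \<in> A - {bt} \<Longrightarrow>
      rel_interior (ncone V P\<^sub>0 (\<phi>\<^sub>0 g)) \<inter> rel_interior (\<phi>\<^sub>1 f) \<noteq> {} \<longleftrightarrow> le g f"
    using bal by (auto simp: balanced_pair_def)
  have p0: "polytope P\<^sub>0" "P\<^sub>0 \<subseteq> V" and p1: "polytope P\<^sub>1"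
    using r0 r1 c0 by (simp_all add: realization_def centered_def)
  have cR: "centered V ?R" using V p1 by (simp add: centered_polar polytope_imp_bounded)
  have R: "polytope ?R" using polytope_polar[OF V c1 p1] .
  note R0 = realizationD[OF bp r0] and R1 = realizationD[OF bp r1]
  have bd: "bt \<in> A" "tp \<in> A" "\<And>x. x \<in> A \<Longrightarrow> le bt x" "\<And>x. x \<in> A \<Longrightarrow> le x tp"
    using bp by (simp_all add: bounded_poset_def)
  have comp: "compact P\<^sub>0" "convex P\<^sub>0" "compact ?R" "convex ?R"
    using p0 R by (simp_all add: polytope_imp_compact polytope_imp_convex)
  have D: "?D f face_of ?R" if "f \<in> A" for f
    using dual_face_face_of[OF V face_of_imp_subset[OF R1(1)[OF that]]] .
  have conv: "convex (\<phi>\<^sub>0 f)" "convex (?D f)" if "f \<in> A" for f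
    using D R0(1) that face_of_imp_convex by blast+
  have Dle: "?D f \<subseteq> ?D f' \<longleftrightarrow> le f' f" if "f \<in> A" "f' \<in> A" for f f'
    using dual_face_subset_iff[OF V c1 p1] R1(1,2) that by simp
  have Dtp: "?D tp = {}"
    using zero_in_centered[OF V c1] by (simp add: R1(6) dual_face_self)
  have Dbt: "?D bt = ?R" by (simp add: R1(5))
  have faceI: "join_hull (\<phi>\<^sub>0 g) (?D f) face_of ?K \<longleftrightarrow> le g f"
    if "g \<in> A" "f \<in> A" "g \<noteq> bt" "f \<noteq> bt" "f \<noteq> tp" for g f
  proof -
    have "\<phi>\<^sub>0 g \<noteq> {}" "\<phi>\<^sub>1 f \<noteq> {}" "\<phi>\<^sub>1 f \<noteq> P\<^sub>1"
      using that R0(4)[of g bt] R1(4)[of f bt] R1(4)[of f tp] bd R0(5) R1(5,6) by simp_all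
    from normal_cone_meets_face_iff[OF V p0 p1 c1 R0(1)[OF that(1)] this(1) R1(1)[OF that(2)] this(2,3)]
    show ?thesis using bal'[of g f] that by simp
  qed
  define \<psi> where "\<psi> = (\<lambda>x. case x of None \<Rightarrow> ?K | Some (g, f) \<Rightarrow> join_hull (\<phi>\<^sub>0 g) (?D f))"
  have psi: "\<psi> None = ?K" "\<psi> (Some (g, f)) = join_hull (\<phi>\<^sub>0 g) (?D f)" for g f
    by (simp_all add: \<psi>_def)
  have face: "\<psi> x face_of ?K" if xc: "x \<in> antiprism_carrier A le" for x
  proof (cases x)
    case None
    then show ?thesis by (simp add: psi face_of_refl_eq join_hull_def)
  next
    case (Some y)
    then obtain g f where x: "x = Some (g, f)" "g \<in> A" "f \<in> A" "le g f"
      using xc by (auto simp: antiprism_carrier_def)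
    \<comment> \<open>For \<open>f = bt\<close> the interval condition forces \<open>g = bt\<close>,
      so a full top occurs here only together with an empty bottom.\<close>
    consider "g = bt" | "f = tp" | "g \<noteq> bt" "f \<noteq> bt" "f \<noteq> tp"
      using x R0(2)[of g f] R0(4)[of g bt] R0(5) bd by auto
    then show ?thesis
    proof cases
      case 1
      then show ?thesis
        using x D by (simp add: psi R0(5) join_hull_empty_face_of(2)[OF comp(2,4)])
    next
      case 2
      then show ?thesis
        using x R0(1) by (simp add: psi Dtp join_hull_empty_face_of(1)[OF comp(2,4)])
    next
      case 3
      then show ?thesis using faceI x by (simp add: psi)
    qed
  qed
  have surj: "\<exists>x \<in> antiprism_carrier A le. \<psi> x = F" if F: "F face_of ?K" for F
  proof -
    obtain G H where GH: "G face_of P\<^sub>0" "H face_of ?R" "F = join_hull G H"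
      using face_of_join_hull_cases[OF comp F] by metis
    obtain g where g: "g \<in> A" "\<phi>\<^sub>0 g = G" using R0(3)[OF GH(1)] by blast
    obtain E where E: "E face_of P\<^sub>1" "dual_face V P\<^sub>1 E = H"
      using dual_face_surj[OF V c1 p1 GH(2)] by metis
    obtain f where f: "f \<in> A" "\<phi>\<^sub>1 f = E" using R1(3)[OF E(1)] by blast
    have F': "F = join_hull (\<phi>\<^sub>0 g) (?D f)" using GH g f E by simp
    show ?thesis
    proof (cases "le g f")
      case True
      then show ?thesis
        using g f F' by (intro bexI[of _ "Some (g, f)"]) (auto simp: psi antiprism_carrier_def)
    next
      case False
      then have ne: "g \<noteq> bt" "f \<noteq> tp" using bd g f by auto
      \<comment> \<open>A face whose indices do not form an interval contradicts balancedness unless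
        its top end is all of \<open>?R\<close>. Then its bottom end, being nonempty, is all of
        \<open>P\<^sub>0\<close>, and the face is the one indexed by \<open>None\<close>.\<close>
      then have "f = bt" using faceI g f F F' False by blast
      then have "F = join_hull (\<phi>\<^sub>0 g) ?R" using F' Dbt by simp
      moreover have "\<phi>\<^sub>0 g \<noteq> {}" using R0(4)[OF g(1) bd(1)] ne R0(5) by simp
      ultimately have "\<phi>\<^sub>0 g = P\<^sub>0"
        using face_of_join_hull_full_top[OF V p0 R cR] conv g F by blast
      with \<open>F = join_hull (\<phi>\<^sub>0 g) ?R\<close> show ?thesis
        by (intro bexI[of _ None]) (auto simp: psi antiprism_carrier_def)
    qed
  qed
  have order: "antiprism_le le x y \<longleftrightarrow> \<psi> x \<subseteq> \<psi> y"
    if x: "x \<in> antiprism_carrier A le" and y: "y \<in> antiprism_carrier A le" for x y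
  proof (cases y)
    case None
    then show ?thesis using face_of_imp_subset[OF face[OF x]] by (simp add: psi)
  next
    case (Some y')
    then obtain g' f' where y': "y = Some (g', f')" "g' \<in> A" "f' \<in> A" "le g' f'"
      using y by (auto simp: antiprism_carrier_def)
    show ?thesis
    proof (cases x)
      case None
      \<comment> \<open>No interval indexes the whole hull: it would satisfy
        \<open>tp \<le> g' \<le> f' \<le> bt\<close>, whereas a realization is nonempty.\<close>
      have "\<not> (P\<^sub>0 \<subseteq> \<phi>\<^sub>0 g' \<and> ?R \<subseteq> ?D f')"
      proof
        assume "P\<^sub>0 \<subseteq> \<phi>\<^sub>0 g' \<and> ?R \<subseteq> ?D f'"
        then have "le tp g'" "le f' bt"
          using R0(2)[OF bd(2) y'(2)] R0(6) Dle[OF bd(1) y'(3)] Dbt by simp_all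
        then have "\<phi>\<^sub>0 tp \<subseteq> \<phi>\<^sub>0 g'" "\<phi>\<^sub>0 g' \<subseteq> \<phi>\<^sub>0 f'" "\<phi>\<^sub>0 f' \<subseteq> \<phi>\<^sub>0 bt"
          using R0(2) bd y' by simp_all
        then have "\<phi>\<^sub>0 tp \<subseteq> \<phi>\<^sub>0 bt" by blast
        then have "\<phi>\<^sub>0 bt = \<phi>\<^sub>0 tp" using R0(5) by simp
        then show False using R0(4)[OF bd(1,2)] R0(7) by simp
      qed
      then show ?thesis
        using None y' conv comp by (simp add: psi join_hull_subset_iff)
    next
      case (Some x')
      then obtain g f where x': "x = Some (g, f)" "g \<in> A" "f \<in> A"
        using x by (auto simp: antiprism_carrier_def)
      then show ?thesis
        using y' conv Dle R0(2) by (simp add: psi join_hull_subset_iff)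
    qed
  qed
  have "inj_on \<psi> (antiprism_carrier A le)"
  proof (rule inj_onI)
    fix x y
    assume xy: "x \<in> antiprism_carrier A le" "y \<in> antiprism_carrier A le" "\<psi> x = \<psi> y"
    then have "antiprism_le le x y" "antiprism_le le y x"
      by (simp_all add: order)
    then show "x = y"
      by (rule antisymp_onD[OF antiprism_le_antisymp[OF bp] xy(1,2)])
  qed
  moreover have "\<psi> ` antiprism_carrier A le = {F. F face_of ?K}"
    using face surj by blast
  ultimately have "face_lattice_iso (antiprism_carrier A le) (antiprism_le le) ?K \<psi>"
    using order by (simp add: face_lattice_iso_def poset_iso_def bij_betw_def)
  then show ?thesis
    using polytope_join_hull[OF p0(1) R] by (auto simp: antiprism_def)
qed

section \<open>From antiprisms to balanced pairs\<close>

text \<open>A locale because its facts serve twice, for the given antiprism and for its projectively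
  normalized image. The condition \<open>nontrivial\<close> holds for indices of a nonempty polytope
  and makes the two end facets nonempty.\<close>

locale antiprism_realization =
  fixes A :: "'p set" and le :: "'p \<Rightarrow> 'p \<Rightarrow> bool" and bt tp :: 'p
    and K :: "'b::euclidean_space set" and \<psi> :: "('p \<times> 'p) option \<Rightarrow> 'b set"
  assumes bp: "bounded_poset A le bt tp" and nontrivial: "bt \<noteq> tp"
    and K: "polytope K"
    and iso: "face_lattice_iso (antiprism_carrier A le) (antiprism_le le) K \<psi>"
begin

lemma bounds: "bt \<in> A" "tp \<in> A" "x \<in> A \<Longrightarrow> le bt x" "x \<in> A \<Longrightarrow> le x tp" "x \<in> A \<Longrightarrow> le x x"
  using bp by (auto simp: bounded_poset_def reflp_on_def)

lemma le_antisym: "x \<in> A \<Longrightarrow> y \<in> A \<Longrightarrow> le x y \<Longrightarrow> le y x \<Longrightarrow> x = y"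
  using bp by (auto simp: bounded_poset_def dest: antisymp_onD)

lemma Some_in_carrier_iff:
  "Some (g, f) \<in> antiprism_carrier A le \<longleftrightarrow> g \<in> A \<and> f \<in> A \<and> le g f"
  by (auto simp: antiprism_carrier_def)

lemma None_in_carrier: "None \<in> antiprism_carrier A le"
  by (simp add: antiprism_carrier_def)

lemma face: "x \<in> antiprism_carrier A le \<Longrightarrow> \<psi> x face_of K"
  using iso by (auto simp: face_lattice_iso_def poset_iso_def dest: bij_betw_apply)

lemma le_iff:
  "x \<in> antiprism_carrier A le \<Longrightarrow> y \<in> antiprism_carrier A le \<Longrightarrow>
    \<psi> x \<subseteq> \<psi> y \<longleftrightarrow> antiprism_le le x y"
  using iso by (simp add: face_lattice_iso_def poset_iso_def)

lemma inj: "inj_on \<psi> (antiprism_carrier A le)"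
  using iso by (simp add: face_lattice_iso_def poset_iso_def bij_betw_def)

lemma faceE:
  assumes "F face_of K"
  obtains x where "x \<in> antiprism_carrier A le" "\<psi> x = F"
proof -
  have "\<psi> ` antiprism_carrier A le = {F. F face_of K}"
    using iso by (simp add: face_lattice_iso_def poset_iso_def bij_betw_def)
  with assms have "F \<in> \<psi> ` antiprism_carrier A le" by simp
  then show thesis by (elim imageE) (rule that, auto)
qed

lemma psi_None: "\<psi> None = K"
proof -
  have "K face_of K" using K by (simp add: face_of_refl polytope_imp_convex)
  then obtain x where x: "x \<in> antiprism_carrier A le" "\<psi> x = K" by (rule faceE)
  then have "K \<subseteq> \<psi> None" using le_iff[OF x(1) None_in_carrier] by simp
  then show ?thesis using face[OF None_in_carrier] face_of_imp_subset by blast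
qed

lemma psi_bot: "\<psi> (Some (bt, tp)) = {}"
proof -
  obtain x where x: "x \<in> antiprism_carrier A le" "\<psi> x = {}" using faceE[OF empty_face_of] .
  have "antiprism_le le (Some (bt, tp)) x"
    using x(1) bounds by (cases x) (auto simp: antiprism_carrier_def)
  then have "\<psi> (Some (bt, tp)) \<subseteq> \<psi> x"
    using le_iff[of "Some (bt, tp)" x] x(1) bounds by (simp add: Some_in_carrier_iff)
  with x show ?thesis by simp
qed

text \<open>The faces of \<open>base\<close> have the indices \<open>(g, tp)\<close> and form a copy
  of the poset; those of \<open>cobase\<close> have the indices \<open>(bt, f)\<close> and form a
  copy of its dual.\<close>

definition "base = \<psi> (Some (tp, tp))"
definition "cobase = \<psi> (Some (bt, bt))"

lemma below_base:
  assumes "F face_of K" "F \<subseteq> base"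
  obtains g where "g \<in> A" "F = \<psi> (Some (g, tp))"
proof -
  obtain x where x: "x \<in> antiprism_carrier A le" "\<psi> x = F" using faceE[OF assms(1)] .
  then have le: "antiprism_le le x (Some (tp, tp))"
    using le_iff[of x "Some (tp, tp)"] assms(2) bounds by (simp add: Some_in_carrier_iff base_def)
  then obtain g f where gf: "x = Some (g, f)" by (cases x) auto
  then have "g \<in> A" "f = tp"
    using x(1) le bounds le_antisym by (auto simp: Some_in_carrier_iff)
  with gf x that show thesis by blast
qed

lemma below_cobase:
  assumes "F face_of K" "F \<subseteq> cobase"
  obtains f where "f \<in> A" "F = \<psi> (Some (bt, f))"
proof -
  obtain x where x: "x \<in> antiprism_carrier A le" "\<psi> x = F" using faceE[OF assms(1)] .
  then have le: "antiprism_le le x (Some (bt, bt))"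
    using le_iff[of x "Some (bt, bt)"] assms(2) bounds by (simp add: Some_in_carrier_iff cobase_def)
  then obtain g f where gf: "x = Some (g, f)" by (cases x) auto
  then have "f \<in> A" "g = bt"
    using x(1) le bounds le_antisym by (auto simp: Some_in_carrier_iff)
  with gf x that show thesis by blast
qed

lemma base_face: "base face_of K" and cobase_face: "cobase face_of K"
  using bounds by (auto simp: base_def cobase_def Some_in_carrier_iff intro!: face)

text \<open>Intersections of faces are meets, and the meet of \<open>(g, f)\<close> and
  \<open>(tp, tp)\<close> is \<open>(g, tp)\<close>. Together with the analogue for
  \<open>cobase\<close>, this reads \<open>g\<close> and \<open>f\<close> off the two ends of a
  face.\<close>

lemma psi_Int_base:
  assumes "g \<in> A" "f \<in> A" "le g f"
  shows "\<psi> (Some (g, f)) \<inter> base = \<psi> (Some (g, tp))"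
proof
  have gf: "Some (g, f) \<in> antiprism_carrier A le" "Some (g, tp) \<in> antiprism_carrier A le"
    "Some (tp, tp) \<in> antiprism_carrier A le"
    using assms bounds by (simp_all add: Some_in_carrier_iff)
  show "\<psi> (Some (g, tp)) \<subseteq> \<psi> (Some (g, f)) \<inter> base"
    using le_iff[OF gf(2,1)] le_iff[OF gf(2,3)] assms bounds by (simp add: base_def)
  have "\<psi> (Some (g, f)) \<inter> base face_of K"
    using face[OF gf(1)] base_face by (rule face_of_Int)
  then obtain g' where g': "g' \<in> A" "\<psi> (Some (g, f)) \<inter> base = \<psi> (Some (g', tp))"
    using below_base by blast
  then have g'c: "Some (g', tp) \<in> antiprism_carrier A le"
    using bounds by (simp add: Some_in_carrier_iff)
  then have "antiprism_le le (Some (g', tp)) (Some (g, f))"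
    using le_iff[OF g'c gf(1)] g'(2) by blast
  then show "\<psi> (Some (g, f)) \<inter> base \<subseteq> \<psi> (Some (g, tp))"
    using le_iff[OF g'c gf(2)] g'(2) bounds by simp
qed

lemma psi_Int_cobase:
  assumes "g \<in> A" "f \<in> A" "le g f"
  shows "\<psi> (Some (g, f)) \<inter> cobase = \<psi> (Some (bt, f))"
proof
  have gf: "Some (g, f) \<in> antiprism_carrier A le" "Some (bt, f) \<in> antiprism_carrier A le"
    "Some (bt, bt) \<in> antiprism_carrier A le"
    using assms bounds by (simp_all add: Some_in_carrier_iff)
  show "\<psi> (Some (bt, f)) \<subseteq> \<psi> (Some (g, f)) \<inter> cobase"
    using le_iff[OF gf(2,1)] le_iff[OF gf(2,3)] assms bounds by (simp add: cobase_def)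
  have "\<psi> (Some (g, f)) \<inter> cobase face_of K"
    using face[OF gf(1)] cobase_face by (rule face_of_Int)
  then obtain f' where f': "f' \<in> A" "\<psi> (Some (g, f)) \<inter> cobase = \<psi> (Some (bt, f'))"
    using below_cobase by blast
  then have f'c: "Some (bt, f') \<in> antiprism_carrier A le"
    using bounds by (simp add: Some_in_carrier_iff)
  then have "antiprism_le le (Some (bt, f')) (Some (g, f))"
    using le_iff[OF f'c gf(1)] f'(2) by blast
  then show "\<psi> (Some (g, f)) \<inter> cobase \<subseteq> \<psi> (Some (bt, f))"
    using le_iff[OF f'c gf(2)] f'(2) bounds by simp
qed

lemma base_cobase_disjoint: "base \<inter> cobase = {}"
  using psi_Int_cobase[of tp tp] bounds psi_bot by (simp add: base_def)

text \<open>Some facet contains this proper face. Its index is an interval that lies above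
  \<open>(tp, tp)\<close>, which leaves only \<open>(tp, tp)\<close> itself.\<close>

lemma base_facet: "base facet_of K"
proof -
  have c: "Some (tp, tp) \<in> antiprism_carrier A le" "Some (bt, tp) \<in> antiprism_carrier A le"
    using bounds by (simp_all add: Some_in_carrier_iff)
  have "base \<noteq> {}"
    using inj_onD[OF inj _ c] psi_bot nontrivial by (auto simp: base_def)
  moreover have "base \<noteq> K"
    using inj_onD[OF inj _ c(1) None_in_carrier] psi_None by (auto simp: base_def)
  ultimately obtain F where F: "F facet_of K" "base \<subseteq> F"
    using face_of_polyhedron_subset_facet[OF polytope_imp_polyhedron[OF K] base_face] by metis
  obtain x where x: "x \<in> antiprism_carrier A le" "\<psi> x = F"
    using faceE[OF facet_of_imp_face_of[OF F(1)]] .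
  have "x \<noteq> None" using x(2) psi_None F(1) by (intro notI) simp
  then obtain g f where gf: "x = Some (g, f)" by (cases x) auto
  have "antiprism_le le (Some (tp, tp)) x"
    using le_iff[OF c(1) x(1)] F(2) x(2) by (simp add: base_def)
  then have "le tp g" "g \<in> A" "f \<in> A" "le g f" using x(1) gf by (auto simp: Some_in_carrier_iff)
  then have "g = tp" using bounds le_antisym by blast
  then have "f = tp" using bounds le_antisym \<open>le g f\<close> \<open>f \<in> A\<close> by blast
  then show ?thesis using F x gf \<open>g = tp\<close> by (simp add: base_def)
qed

lemma cobase_facet: "cobase facet_of K"
proof -
  have c: "Some (bt, bt) \<in> antiprism_carrier A le" "Some (bt, tp) \<in> antiprism_carrier A le"
    using bounds by (simp_all add: Some_in_carrier_iff)
  have "cobase \<noteq> {}"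
    using inj_onD[OF inj _ c] psi_bot nontrivial by (auto simp: cobase_def)
  moreover have "cobase \<noteq> K"
    using inj_onD[OF inj _ c(1) None_in_carrier] psi_None by (auto simp: cobase_def)
  ultimately obtain F where F: "F facet_of K" "cobase \<subseteq> F"
    using face_of_polyhedron_subset_facet[OF polytope_imp_polyhedron[OF K] cobase_face] by metis
  obtain x where x: "x \<in> antiprism_carrier A le" "\<psi> x = F"
    using faceE[OF facet_of_imp_face_of[OF F(1)]] .
  have "x \<noteq> None" using x(2) psi_None F(1) by (intro notI) simp
  then obtain g f where gf: "x = Some (g, f)" by (cases x) auto
  have "antiprism_le le (Some (bt, bt)) x"
    using le_iff[OF c(1) x(1)] F(2) x(2) by (simp add: cobase_def)
  then have "le f bt" "g \<in> A" "f \<in> A" "le g f" using x(1) gf by (auto simp: Some_in_carrier_iff)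
  then have "f = bt" using bounds le_antisym by blast
  then have "g = bt" using bounds le_antisym \<open>le g f\<close> \<open>g \<in> A\<close> by blast
  then show ?thesis using F x gf \<open>f = bt\<close> by (simp add: cobase_def)
qed

text \<open>By the vertices: if the index \<open>(g, f)\<close> of a vertex has
  \<open>g = bt\<close>, the vertex lies in \<open>cobase\<close>; otherwise its slice
  \<open>(g, tp)\<close> in \<open>base\<close> is a nonempty part of a single point. The index
  \<open>None\<close> would make \<open>K\<close> a point, which then lies in the nonempty
  \<open>base\<close>.\<close>

lemma eq_convex_hull_bases: "K = convex hull (base \<union> cobase)"
proof -
  have ext: "v \<in> base \<union> cobase" if v: "v extreme_point_of K" for v
  proof -
    have "{v} face_of K" using v by (simp add: face_of_singleton)
    then obtain x where x: "x \<in> antiprism_carrier A le" "\<psi> x = {v}" by (rule faceE)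
    have sub: "y = v" if "y \<in> F" "F \<subseteq> \<psi> x" for y F using that x by auto
    show ?thesis
    proof (cases x)
      case None
      obtain y where "y \<in> base" using base_facet by (auto simp: facet_of_def)
      moreover have "base \<subseteq> \<psi> x" using None psi_None base_face face_of_imp_subset by blast
      ultimately show ?thesis using sub by blast
    next
      case (Some z)
      then obtain g f where gf: "x = Some (g, f)" "g \<in> A" "f \<in> A" "le g f"
        using x(1) by (cases z) (auto simp: Some_in_carrier_iff)
      show ?thesis
      proof (cases "g = bt")
        case True
        then have "\<psi> x \<subseteq> cobase"
          using le_iff[of x "Some (bt, bt)"] x(1) gf bounds
          by (simp add: Some_in_carrier_iff cobase_def)
        with x show ?thesis by blast
      next
        case False
        have "\<psi> (Some (g, tp)) \<noteq> {}"
          using inj_onD[OF inj, of "Some (g, tp)" "Some (bt, tp)"] psi_bot False gf bounds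
          by (auto simp: Some_in_carrier_iff)
        then obtain y where "y \<in> \<psi> x" "y \<in> base"
          using psi_Int_base[OF gf(2-4)] gf(1) by blast
        with x show ?thesis by auto
      qed
    qed
  qed
  have "K = convex hull {v. v extreme_point_of K}"
    using K by (intro Krein_Milman_Minkowski polytope_imp_compact polytope_imp_convex)
  also have "\<dots> \<subseteq> convex hull (base \<union> cobase)"
    using ext by (intro hull_mono) blast
  finally have "K \<subseteq> convex hull (base \<union> cobase)" .
  moreover have "convex hull (base \<union> cobase) \<subseteq> K"
    using base_face cobase_face K
    by (intro hull_minimal) (auto simp: polytope_imp_convex dest: face_of_imp_subset)
  ultimately show ?thesis by blast
qed

lemma base_realization: "realization A le base (\<lambda>g. \<psi> (Some (g, tp)))"
proof -
  have c: "Some (g, tp) \<in> antiprism_carrier A le" if "g \<in> A" for g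
    using that bounds by (simp add: Some_in_carrier_iff)
  have "inj_on (\<lambda>g. \<psi> (Some (g, tp))) A"
    using c inj_onD[OF inj] by (intro inj_onI) blast
  moreover have "(\<lambda>g. \<psi> (Some (g, tp))) ` A = {F. F face_of base}"
  proof (intro equalityI subsetI)
    fix F assume "F \<in> (\<lambda>g. \<psi> (Some (g, tp))) ` A"
    then obtain g where g: "g \<in> A" "F = \<psi> (Some (g, tp))" by blast
    then have "F \<subseteq> base"
      using le_iff[of "Some (g, tp)" "Some (tp, tp)"] bounds by (simp add: Some_in_carrier_iff base_def)
    then show "F \<in> {F. F face_of base}"
      using face_of_face[OF base_face] face[OF c[OF g(1)]] g(2) by simp
  next
    fix F assume "F \<in> {F. F face_of base}"
    then have "F face_of K" "F \<subseteq> base" using face_of_face[OF base_face] by simp_all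
    then show "F \<in> (\<lambda>g. \<psi> (Some (g, tp))) ` A" by (rule below_base) blast
  qed
  moreover have "le g g' \<longleftrightarrow> \<psi> (Some (g, tp)) \<subseteq> \<psi> (Some (g', tp))" if "g \<in> A" "g' \<in> A" for g g'
    using le_iff[OF c c] that bounds by simp
  moreover have "polytope base" "base \<noteq> {}"
    using base_facet K face_of_polytope_polytope[OF K base_face] by (auto simp: facet_of_def)
  ultimately show ?thesis
    by (simp add: realization_def face_lattice_iso_def poset_iso_def bij_betw_def)
qed

lemma cobase_faces:
  "f \<in> A \<Longrightarrow> \<psi> (Some (bt, f)) face_of cobase"
  "f \<in> A \<Longrightarrow> f' \<in> A \<Longrightarrow> \<psi> (Some (bt, f)) \<subseteq> \<psi> (Some (bt, f')) \<longleftrightarrow> le f' f"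
  "F face_of cobase \<Longrightarrow> \<exists>f\<in>A. F = \<psi> (Some (bt, f))"
proof -
  have c: "Some (bt, f) \<in> antiprism_carrier A le" if "f \<in> A" for f
    using that bounds by (simp add: Some_in_carrier_iff)
  show "\<psi> (Some (bt, f)) \<subseteq> \<psi> (Some (bt, f')) \<longleftrightarrow> le f' f" if "f \<in> A" "f' \<in> A" for f f'
    using le_iff[OF c c] that bounds by simp
  then have "\<psi> (Some (bt, f)) \<subseteq> cobase" if "f \<in> A" for f
    using that bounds by (simp add: cobase_def)
  then show "\<psi> (Some (bt, f)) face_of cobase" if "f \<in> A" for f
    using face_of_face[OF cobase_face] face[OF c[OF that]] that by simp
  show "\<exists>f\<in>A. F = \<psi> (Some (bt, f))" if "F face_of cobase" for F
  proof -
    have "F face_of K" "F \<subseteq> cobase" using that face_of_face[OF cobase_face] by simp_all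
    then show ?thesis by (rule below_cobase) blast
  qed
qed

lemma segment_preserving_image:
  assumes "preserves_segments K T"
  shows "antiprism_realization A le bt tp (T ` K) (\<lambda>x. T ` \<psi> x)"
  using assms K iso bp nontrivial
  by unfold_locales (auto intro: preserves_segments_polytope preserves_segments_face_lattice_iso
      polytope_imp_convex)

end

text \<open>For a normalized antiprism, whose end facets are parallel and centered, \<open>K\<close>
  is \<open>join_hull P R\<close>, and the face criterion can be read backwards with
  \<open>polar V R\<close> as second polytope.\<close>

lemma antiprism_imp_balanced_pair:
  fixes P R V :: "'a::euclidean_space set"
    and K :: "('a \<times> real) set" and \<psi> :: "('p \<times> 'p) option \<Rightarrow> ('a \<times> real) set"
  assumes "antiprism_realization A le bt tp K \<psi>"
    and V: "subspace V" and cP: "centered V P" and cR: "centered V R"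
    and base: "\<psi> (Some (tp, tp)) = P \<times> {0}" and cobase: "\<psi> (Some (bt, bt)) = R \<times> {1}"
  shows "\<exists>\<phi> \<phi>'. balanced_pair A le bt V P \<phi> (polar V R) \<phi>'"
proof -
  interpret antiprism_realization A le bt tp K \<psi> by fact
  have base': "base = P \<times> {0}" and cobase': "cobase = R \<times> {1}"
    using base cobase by (simp_all add: base_def cobase_def)
  have K_eq: "K = join_hull P R"
    using eq_convex_hull_bases by (simp add: base' cobase' join_hull_def)
  have "polytope (fst ` base)" "polytope (fst ` cobase)"
    using face_of_polytope_polytope[OF K base_face] face_of_polytope_polytope[OF K cobase_face]
    by (auto intro: polytope_linear_image linear_fst)
  then have P: "polytope P" and R: "polytope R"
    by (simp_all add: base' cobase' image_image fst_image_times)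
  have PV: "P \<subseteq> V" using centered_imp_subset[OF cP] .
  have comp: "compact P" "convex P" "compact R" "convex R"
    using P R by (simp_all add: polytope_imp_compact polytope_imp_convex)
  let ?P' = "polar V R"
  have P': "polytope ?P'" "centered V ?P'"
    using polytope_polar[OF V cR R] centered_polar[OF V polytope_imp_bounded[OF R]] by simp_all
  have RR: "polar V ?P' = R"
    using V cR R by (simp add: polar_polar polytope_imp_closed polytope_imp_convex)
  define \<phi> where "\<phi> g = {x. (x, 0) \<in> \<psi> (Some (g, tp))}" for g
  define \<rho> where "\<rho> f = {x. (x, 1) \<in> \<psi> (Some (bt, f))}" for f
  \<comment> \<open>The cobase indexes the faces of \<open>R\<close> in reversed order; dualizing
    reverses them once more, so \<open>\<phi>'\<close> realizes the original poset.\<close>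
  define \<phi>' where "\<phi>' f = dual_face V R (\<rho> f)" for f
  note base_real = realizationD[OF bp base_realization]
  have \<phi>: "\<psi> (Some (g, tp)) = \<phi> g \<times> {0}" if "g \<in> A" for g
    using face_of_imp_subset[OF base_real(1)[OF that]] by (auto simp: \<phi>_def base')
  have \<rho>: "\<psi> (Some (bt, f)) = \<rho> f \<times> {1}" if "f \<in> A" for f
    using face_of_imp_subset[OF cobase_faces(1)[OF that]] by (auto simp: \<rho>_def cobase')
  have \<phi>_sub: "\<phi> g \<subseteq> \<phi> g' \<longleftrightarrow> le g g'" if "g \<in> A" "g' \<in> A" for g g'
    using base_real(2)[OF that] \<phi> that by (auto simp: times_subset_iff)
  have \<rho>_sub: "\<rho> f \<subseteq> \<rho> f' \<longleftrightarrow> le f' f" if "f \<in> A" "f' \<in> A" for f f'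
    using cobase_faces(2)[OF that] \<rho> that by (auto simp: times_subset_iff)
  have \<phi>_face: "\<phi> g face_of P" if "g \<in> A" for g
    using base_real(1)[OF that] \<phi>[OF that] by (simp add: base' face_of_Times_singleton)
  have \<rho>_face: "\<rho> f face_of R" if "f \<in> A" for f
    using cobase_faces(1)[OF that] \<rho>[OF that] by (simp add: cobase' face_of_Times_singleton)
  have \<phi>_surj: "\<exists>g\<in>A. \<phi> g = F" if "F face_of P" for F
  proof -
    have "F \<times> {0} face_of base" using that by (simp add: base' face_of_Times_singleton)
    then obtain g where "g \<in> A" "\<psi> (Some (g, tp)) = F \<times> {0}" using base_real(3) by blast
    then show ?thesis using \<phi>[of g] by (intro bexI[of _ g]) auto
  qed
  have \<rho>_surj: "\<exists>f\<in>A. \<rho> f = F" if "F face_of R" for F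
  proof -
    have "F \<times> {1} face_of cobase" using that by (simp add: cobase' face_of_Times_singleton)
    then obtain f where "f \<in> A" "\<psi> (Some (bt, f)) = F \<times> {1}" using cobase_faces(3) by metis
    then show ?thesis using \<rho>[of f] by (intro bexI[of _ f]) auto
  qed
  have \<phi>_bot: "\<phi> bt = {}" and \<rho>_bot: "\<rho> tp = {}" using psi_bot by (simp_all add: \<phi>_def \<rho>_def)
  have \<rho>_top: "\<rho> bt = R" using cobase by (simp add: \<rho>_def)
  have \<phi>_inj: "\<phi> g = \<phi> g' \<longleftrightarrow> g = g'" if "g \<in> A" "g' \<in> A" for g g'
    using \<phi>_sub[OF that] \<phi>_sub[OF that(2,1)] le_antisym that by auto
  have \<rho>_inj: "\<rho> f = \<rho> f' \<longleftrightarrow> f = f'" if "f \<in> A" "f' \<in> A" for f f'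
    using \<rho>_sub[OF that] \<rho>_sub[OF that(2,1)] le_antisym that by auto
  have dual: "dual_face V ?P' (\<phi>' f) = \<rho> f" if "f \<in> A" for f
    unfolding \<phi>'_def using dual_face_dual_face[OF V cR R \<rho>_face[OF that]] .
  have \<phi>'_sub: "\<phi>' f \<subseteq> \<phi>' f' \<longleftrightarrow> le f f'" if "f \<in> A" "f' \<in> A" for f f'
    unfolding \<phi>'_def using dual_face_subset_iff[OF V cR R] \<rho>_face \<rho>_sub that by simp
  have \<phi>'_face: "\<phi>' f face_of ?P'" if "f \<in> A" for f
    unfolding \<phi>'_def using dual_face_face_of[OF V face_of_imp_subset[OF \<rho>_face[OF that]]] .
  have \<phi>'_surj: "\<exists>f\<in>A. \<phi>' f = F" if F: "F face_of ?P'" for F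
  proof -
    obtain E where E: "E face_of R" "dual_face V R E = F" using dual_face_surj[OF V cR R F] by metis
    then obtain f where "f \<in> A" "\<rho> f = E" using \<rho>_surj by blast
    with E show ?thesis unfolding \<phi>'_def by blast
  qed
  have \<phi>'_top: "\<phi>' tp = ?P'" unfolding \<phi>'_def \<rho>_bot by simp
  have \<phi>'_inj: "\<phi>' f = \<phi>' f' \<longleftrightarrow> f = f'" if "f \<in> A" "f' \<in> A" for f f'
    using \<phi>'_sub[OF that] \<phi>'_sub[OF that(2,1)] le_antisym that by auto
  have \<phi>'_bot: "\<phi>' bt = {}"
    unfolding \<phi>'_def \<rho>_top using dual_face_self[OF zero_in_centered[OF V cR]] .
  have real: "realization A le P \<phi>"
    using P zero_in_centered[OF V cP] \<phi>_face \<phi>_surj \<phi>_sub \<phi>_inj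
    by (auto simp: realization_def face_lattice_iso_def poset_iso_def bij_betw_def inj_on_def)
  have real': "realization A le ?P' \<phi>'"
    using P'(1) zero_in_centered[OF V P'(2)] \<phi>'_face \<phi>'_surj \<phi>'_sub \<phi>'_inj
    by (auto simp: realization_def face_lattice_iso_def poset_iso_def bij_betw_def inj_on_def)
  \<comment> \<open>Points of height 0 in \<open>K\<close> belong to \<open>base\<close>, so the
    slice of a face is its intersection with \<open>base\<close>. Hence the face indexed by
    \<open>(g, f)\<close> is the hull of \<open>\<phi> g\<close> and
    \<open>\<rho> f\<close>.\<close>
  have slice0: "{x. (x, 0) \<in> \<psi> (Some (g, f))} = \<phi> g" if "g \<in> A" "f \<in> A" "le g f" for g f
  proof -
    have "\<psi> (Some (g, f)) \<subseteq> K"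
      using that face by (intro face_of_imp_subset) (simp add: Some_in_carrier_iff)
    then have "(x, 0) \<in> \<psi> (Some (g, f)) \<Longrightarrow> (x, 0) \<in> base" for x
      using comp by (auto simp: K_eq base' join_hull_0_iff)
    then show ?thesis using psi_Int_base[OF that] by (auto simp: \<phi>_def)
  qed
  have slice1: "{x. (x, 1) \<in> \<psi> (Some (g, f))} = \<rho> f" if "g \<in> A" "f \<in> A" "le g f" for g f
  proof -
    have "\<psi> (Some (g, f)) \<subseteq> K"
      using that face by (intro face_of_imp_subset) (simp add: Some_in_carrier_iff)
    then have "(x, 1) \<in> \<psi> (Some (g, f)) \<Longrightarrow> (x, 1) \<in> cobase" for x
      using comp by (auto simp: K_eq cobase' join_hull_1_iff)
    then show ?thesis using psi_Int_cobase[OF that] by (auto simp: \<rho>_def)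
  qed
  have face_iff: "join_hull (\<phi> g) (\<rho> f) face_of K \<longleftrightarrow> le g f"
    if gf: "g \<in> A" "f \<in> A" "f \<noteq> bt" for g f
  proof
    assume "le g f"
    then have F: "\<psi> (Some (g, f)) face_of K" using gf face by (simp add: Some_in_carrier_iff)
    then show "join_hull (\<phi> g) (\<rho> f) face_of K"
      using face_of_join_hull_eq[OF comp(1,3) F[unfolded K_eq]] slice0 slice1 gf \<open>le g f\<close> by simp
  next
    assume "join_hull (\<phi> g) (\<rho> f) face_of K"
    then obtain x where x: "x \<in> antiprism_carrier A le" "\<psi> x = join_hull (\<phi> g) (\<rho> f)"
      by (rule faceE)
    have conv: "convex (\<phi> g)" "convex (\<rho> f)"
      using \<phi>_face \<rho>_face gf by (auto intro: face_of_imp_convex)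
    have s: "{z. (z, 0) \<in> \<psi> x} = \<phi> g" "{z. (z, 1) \<in> \<psi> x} = \<rho> f"
      unfolding x(2) using conv by (simp_all add: join_hull_0_iff join_hull_1_iff)
    show "le g f"
    proof (cases x)
      \<comment> \<open>The whole of \<open>K\<close> is a hull of this form without coming from an
        interval. Its top end is \<open>R\<close>, the face indexed by \<open>bt\<close>, and
        \<open>f \<noteq> bt\<close> excludes this.\<close>
      case None
      then have "\<rho> f = R" using s(2) comp by (simp add: psi_None K_eq join_hull_1_iff)
      then show ?thesis using \<rho>_inj[of f bt] \<rho>_top gf bounds by simp
    next
      case (Some y)
      then obtain g' f' where x': "x = Some (g', f')" "g' \<in> A" "f' \<in> A" "le g' f'"
        using x(1) by (cases y) (auto simp: Some_in_carrier_iff)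
      then have "g' = g" "f' = f"
        using s slice0[OF x'(2-4)] slice1[OF x'(2-4)] \<phi>_inj \<rho>_inj gf by auto
      with x' show ?thesis by simp
    qed
  qed
  have "rel_interior (ncone V P (\<phi> g)) \<inter> rel_interior (\<phi>' f) \<noteq> {} \<longleftrightarrow> le g f"
    if gf: "g \<in> A - {bt}" "f \<in> A - {bt}" for g f
  proof -
    have g: "g \<in> A" "\<phi> g \<noteq> {}" using gf \<phi>_inj[of g bt] \<phi>_bot bounds by auto
    show ?thesis
    proof (cases "f = tp")
      \<comment> \<open>Here \<open>\<phi>' f\<close> is the whole polar and its dual face is empty,
        so the hull criterion does not apply; both sides hold outright.\<close>
      case True
      then show ?thesis
        using normal_cone_meets_centered[OF V P PV P'(2) \<phi>_face[OF g(1)] g(2)] \<phi>'_top bounds g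
        by simp
    next
      case False
      have f: "f \<in> A" "\<phi>' f \<noteq> {}" "\<phi>' f \<noteq> ?P'"
        using gf False \<phi>'_inj[of f bt] \<phi>'_inj[of f tp] \<phi>'_bot \<phi>'_top bounds by auto
      show ?thesis
        using normal_cone_meets_face_iff[OF V P PV P' \<phi>_face[OF g(1)] g(2) \<phi>'_face[OF f(1)] f(2,3)]
          dual[OF f(1)] RR face_iff[OF g(1) f(1)] gf by (simp add: K_eq)
    qed
  qed
  then have "balanced_pair A le bt V P \<phi> ?P' \<phi>'"
    using V real real' cP P'(2) by (simp add: balanced_pair_def)
  then show ?thesis by blast
qed

text \<open>The type of the antiprism does not bound the space of the pair. The bound comes from
  \<open>Q\<close>: the facet \<open>base\<close> realizes the same poset, so \<open>K\<close> has
  dimension at most one more than that of \<open>'a\<close>, and its normalization fits into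
  \<open>'a \<times> real\<close>.\<close>

lemma has_antiprism_imp_has_balanced_pair:
  fixes Q :: "'a::euclidean_space set"
  assumes bp: "bounded_poset A le bt tp" and Q: "realization A le Q \<phi>"
    and "has_antiprism TYPE('b::euclidean_space) A le"
  shows "has_balanced_pair TYPE('a) A le bt"
proof -
  obtain K :: "'b set" and \<psi> where K: "polytope K"
    "face_lattice_iso (antiprism_carrier A le) (antiprism_le le) K \<psi>"
    using assms(3) by (auto simp: has_antiprism_def antiprism_def)
  interpret antiprism_realization A le bt tp K \<psi>
    using K bp realizationD(7)[OF bp Q] by unfold_locales
  have "aff_dim base = aff_dim Q"
    using base_realization Q by (auto simp: realization_def intro: aff_dim_eq_face_lattice)
  then have "aff_dim K \<le> int DIM('a) + 1"
    using base_facet aff_dim_le_DIM[of Q] by (simp add: facet_of_def)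
  then obtain T :: "'b \<Rightarrow> 'a \<times> real" and V P R
    where T: "preserves_segments K T" "subspace V" "centered V P" "centered V R"
      "T ` base = P \<times> {0}" "T ` cobase = R \<times> {1}"
    using disjoint_facets_normalization[OF K(1) base_facet cobase_facet base_cobase_disjoint]
    by metis
  show ?thesis
    using antiprism_imp_balanced_pair[OF segment_preserving_image[OF T(1)] T(2-4)] T(5,6)
    by (auto simp: has_balanced_pair_def base_def cobase_def)
qed

text \<open>A linear map that is isometric on \<open>S\<close> is injective on \<open>K\<close>,
  hence preserves segments there and carries the face lattice along.\<close>

lemma antiprism_transfer:
  fixes K :: "'c::euclidean_space set"
  assumes K: "antiprism A le K" "K \<subseteq> S" and S: "subspace S" "dim S \<le> DIM('b)"
  shows "has_antiprism TYPE('b::euclidean_space) A le"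
proof -
  have "dim S \<le> dim (UNIV :: 'b set)" using S(2) by simp
  then obtain h :: "'c \<Rightarrow> 'b" where h: "linear h" "\<And>x. x \<in> S \<Longrightarrow> norm (h x) = norm x"
    using isometry_subset_subspace[OF S(1) subspace_UNIV] by metis
  interpret h: linear h by (rule h(1))
  have poly: "polytope K" using K by (simp add: antiprism_def)
  have "inj_on h K"
  proof (rule inj_onI)
    fix x y assume xy: "x \<in> K" "y \<in> K" "h x = h y"
    then have "h (x - y) = 0" by (simp add: h.diff)
    moreover have "x - y \<in> S" using xy K(2) S(1) by (auto intro: subspace_diff)
    ultimately show "x = y" using h(2)[of "x - y"] by simp
  qed
  then have "preserves_segments K h"
    using poly by (intro preserves_segments_affine) (auto simp: h.add h.scaleR polytope_imp_convex)
  then have "antiprism A le (h ` K)"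
    using K(1) preserves_segments_polytope preserves_segments_face_lattice_iso polytope_imp_convex
    unfolding antiprism_def by blast
  then show ?thesis by (auto simp: has_antiprism_def)
qed

text \<open>A centered realization spans \<open>V\<close>, so \<open>dim V\<close> equals the
  dimension of \<open>Q\<close>. The strict inequality leaves one more dimension in
  \<open>'b\<close> for the height coordinate.\<close>

lemma has_balanced_pair_imp_has_antiprism:
  fixes Q :: "'a::euclidean_space set"
  assumes bp: "bounded_poset A le bt tp" and Q: "realization A le Q \<phi>"
    and dim: "aff_dim Q < int DIM('b::euclidean_space)"
    and bal: "has_balanced_pair TYPE('a) A le bt"
  shows "has_antiprism TYPE('b) A le"
proof -
  obtain V P\<^sub>0 P\<^sub>1 :: "'a set" and \<phi>\<^sub>0 \<phi>\<^sub>1 where bal: "balanced_pair A le bt V P\<^sub>0 \<phi>\<^sub>0 P\<^sub>1 \<phi>\<^sub>1"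
    using bal by (auto simp: has_balanced_pair_def)
  then have V: "subspace V" and P0: "realization A le P\<^sub>0 \<phi>\<^sub>0" "centered V P\<^sub>0"
    by (simp_all add: balanced_pair_def)
  have "aff_dim P\<^sub>0 = aff_dim Q"
    using P0 Q by (auto simp: realization_def intro: aff_dim_eq_face_lattice)
  moreover have "aff_dim P\<^sub>0 = aff_dim V"
    using aff_dim_affine_hull[of P\<^sub>0] centered_imp_affine_hull[OF V P0(2)] by simp
  ultimately have "dim V < DIM('b)" using dim aff_dim_subspace[OF V] by simp
  moreover have "dim (V \<times> (UNIV :: real set)) = dim V + 1"
    using dim_Times[OF V subspace_UNIV[where 'a = real]] by simp
  ultimately have "dim (V \<times> (UNIV :: real set)) \<le> DIM('b)" by simp
  moreover have "subspace (V \<times> (UNIV :: real set))"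
    using V by (intro subspace_Times) auto
  moreover have "join_hull P\<^sub>0 (polar V P\<^sub>1) \<subseteq> V \<times> UNIV"
    unfolding join_hull_def
    using centered_imp_subset[OF P0(2)] polar_subset[of V P\<^sub>1] \<open>subspace (V \<times> UNIV)\<close>
    by (intro hull_minimal) (auto simp: subspace_imp_convex)
  ultimately show ?thesis
    using balanced_pair_imp_antiprism[OF bp bal] by (intro antiprism_transfer)
qed

theorem theorem3p2:
  fixes A :: "'p set"
    and le :: "'p \<Rightarrow> 'p \<Rightarrow> bool"
    and bt tp :: 'p
    and Q :: "'a::euclidean_space set"
    and \<phi> :: "'p \<Rightarrow> 'a set"
  assumes "bounded_poset A le bt tp"
    and "realization A le Q \<phi>"
    and "aff_dim Q < int DIM('b::euclidean_space)"
  shows "(has_antiprism TYPE('b) A le \<longleftrightarrow> has_balanced_pair TYPE('a) A le bt) \<and>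
    (\<forall>(V :: 'a set) P\<^sub>0 \<phi>\<^sub>0 P\<^sub>1 \<phi>\<^sub>1. balanced_pair A le bt V P\<^sub>0 \<phi>\<^sub>0 P\<^sub>1 \<phi>\<^sub>1 \<longrightarrow>
       antiprism A le (convex hull (P\<^sub>0 \<times> {0} \<union> polar V P\<^sub>1 \<times> {1::real})))"
  using has_antiprism_imp_has_balanced_pair[OF assms(1,2)]
    has_balanced_pair_imp_has_antiprism[OF assms]
    balanced_pair_imp_antiprism[OF assms(1), unfolded join_hull_def] by blast

end
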